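(* Let $M_n$ be the random DAG constructed as in the context. There exists a constant $c'>0$ such that (with high probability over the random edges) for every set $S\subseteq V(M_n)$ with $|S|\le c'n/2$, $M_n$ is $(|S|,n-|S|)$-ST-robust; moreover $M_n$ has $n$ inputs, $n$ outputs and constant indegree.
   Context: A DAG is $(e,d)$-depth-robust if deleting any at most $e$ nodes leaves a directed path of length $d$. An $n$-superconcentrator is a DAG with $n$ inputs and $n$ outputs such that for every $1\le r\le n$, any $r$ inputs and any $r$ outputs, there are $r$ vertex-disjoint paths connecting the set of these inputs to the set of these outputs. Let $(H_n)$ be a family of DAGs with $H_n$ having $n$ nodes, constant indegree, and being $(cn,n^{2/3})$-depth-robust for a constant $c>0$. Let $G_n$ be formed from three disjoint copies $H_n^1,H_n^2,H_n^3$ (vertex sets $V_1,V_2,V_3$) by adding, for each $v\in V_3$, edges into $v$ from $\tau$ vertices of $V_2$ sampled independently and uniformly at random, and for each $u\in V_2$, edges into $u$ from $\tau$ vertices of $V_1$ sampled independently and uniformly at random, where $\tau$ is a suitable constant. $M_n$: take linear-size $n$-superconcentrators $SC_n^1, SC_n^2$ of constant indegree and $G_n$; connect each output of $SC_n^1$ by an edge to a distinct node of $H_n^1$, and each node of $H_n^3$ by an edge to a distinct input of $SC_n^2$. The inputs of $M_n$ are the inputs of $SC_n^1$ and the outputs of $M_n$ are the outputs of $SC_n^2$. For a DAG with a set $I$ of $n$ inputs and a set $O$ of $n$ outputs, it is $(k_1,k_2)$-ST-robust if for every node set $D$ with $|D|\le k_1$ there is a subgraph $H$ of the graph minus $D$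 with $|I\cap V(H)|\ge k_2$, $|O\cap V(H)|\ge k_2$, such that every $s\in I\cap V(H)$ has a directed path in $H$ to every $t\in O\cap V(H)$. *)

theory Defs
  imports "HOL-Probability.Probability" "Graph_Theory.Graph_Theory"
begin

definition dag :: "'a pair_pre_digraph \<Rightarrow> bool" where
  "dag G \<longleftrightarrow> pair_fin_digraph G \<and> acyclic (parcs G)"

abbreviation del_verts :: "'a pair_pre_digraph \<Rightarrow> 'a set \<Rightarrow> ('a, 'a \<times> 'a) pre_digraph" where
  "del_verts G D \<equiv> induce_subgraph (with_proj G) (pverts G - D)"

definition indegree_le :: "nat \<Rightarrow> 'a pair_pre_digraph \<Rightarrow> bool" where
  "indegree_le k G \<longleftrightarrow> (\<forall>v\<in>pverts G. in_degree (with_proj G) v \<le> k)"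

text \<open>The length of a path is its number of arcs.  Since \<open>d\<close> may be non-integral, a path of
  length \<open>d\<close> is understood as one of length at least \<open>d\<close>.\<close>

definition depth_robust :: "real \<Rightarrow> real \<Rightarrow> 'a pair_pre_digraph \<Rightarrow> bool" where
  "depth_robust e d G \<longleftrightarrow>
     (\<forall>D. D \<subseteq> pverts G \<and> real (card D) \<le> e \<longrightarrow>
        (\<exists>u p v. pre_digraph.apath (del_verts G D) u p v \<and> d \<le> real (length p)))"

record 'a io_graph =
  graph :: "'a pair_pre_digraph"
  inputs :: "'a set"
  outputs :: "'a set"

definition io_dag :: "nat \<Rightarrow> 'a io_graph \<Rightarrow> bool" where
  "io_dag n X \<longleftrightarrow> dag (graph X) \<and>
     inputs X \<subseteq> pverts (graph X) \<and> card (inputs X) = n \<and>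
     outputs X \<subseteq> pverts (graph X) \<and> card (outputs X) = n"

definition superconcentrator :: "nat \<Rightarrow> 'a io_graph \<Rightarrow> bool" where
  "superconcentrator n X \<longleftrightarrow> io_dag n X \<and>
     (\<forall>r A B. 1 \<le> r \<and> r \<le> n \<and> A \<subseteq> inputs X \<and> card A = r \<and> B \<subseteq> outputs X \<and> card B = r \<longrightarrow>
        (\<exists>u p v.
           (\<forall>i<r. pre_digraph.apath (with_proj (graph X)) (u i) (p i) (v i) \<and>
                  u i \<in> A \<and> v i \<in> B) \<and>
           (\<forall>i<r. \<forall>j<r. i \<noteq> j \<longrightarrow>
              set (pre_digraph.awalk_verts (with_proj (graph X)) (u i) (p i)) \<inter>
              set (pre_digraph.awalk_verts (with_proj (graph X)) (u j) (p j)) = {})))"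

definition st_robust :: "nat \<Rightarrow> nat \<Rightarrow> 'a io_graph \<Rightarrow> bool" where
  "st_robust k1 k2 X \<longleftrightarrow>
     (\<forall>D. D \<subseteq> pverts (graph X) \<and> card D \<le> k1 \<longrightarrow>
        (\<exists>H. subgraph H (del_verts (graph X) D) \<and>
             k2 \<le> card (inputs X \<inter> verts H) \<and> k2 \<le> card (outputs X \<inter> verts H) \<and>
             (\<forall>s\<in>inputs X \<inter> verts H. \<forall>t\<in>outputs X \<inter> verts H. s \<rightarrow>\<^sup>*\<^bsub>H\<^esub> t)))"

definition linear_superconcentrators :: "(nat \<Rightarrow> 'a io_graph) \<Rightarrow> bool" where
  "linear_superconcentrators SC \<longleftrightarrow>
     (\<forall>n. superconcentrator n (SC n)) \<and>
     (\<exists>K. \<forall>n. card (pverts (graph (SC n))) \<le> K * n) \<and>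
     (\<exists>k. \<forall>n. indegree_le k (graph (SC n)))"

datatype 'a gnode = V1 'a | V2 'a | V3 'a

text \<open>The arcs added between the copies are determined by a function \<open>\<omega>\<close>: the \<open>i\<close>-th
  sampled in-neighbour of \<open>V3 v\<close> is \<open>V2 (\<omega> (V3 v, i))\<close>, that of \<open>V2 u\<close> is
  \<open>V1 (\<omega> (V2 u, i))\<close>.\<close>

definition samples :: "nat \<Rightarrow> 'a pair_pre_digraph \<Rightarrow> ('a gnode \<times> nat \<Rightarrow> 'a) pmf" where
  "samples \<tau> H =
     Pi_pmf ((V2 ` pverts H \<union> V3 ` pverts H) \<times> {..<\<tau>}) undefined (\<lambda>_. pmf_of_set (pverts H))"

definition G_graph ::
  "nat \<Rightarrow> 'a pair_pre_digraph \<Rightarrow> ('a gnode \<times> nat \<Rightarrow> 'a) \<Rightarrow> 'a gnode pair_pre_digraph" where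
  "G_graph \<tau> H \<omega> = \<lparr>
     pverts = V1 ` pverts H \<union> V2 ` pverts H \<union> V3 ` pverts H,
     parcs = map_prod V1 V1 ` parcs H \<union> map_prod V2 V2 ` parcs H \<union> map_prod V3 V3 ` parcs H \<union>
       {(V1 (\<omega> (V2 u, i)), V2 u) | u i. u \<in> pverts H \<and> i < \<tau>} \<union>
       {(V2 (\<omega> (V3 v, i)), V3 v) | v i. v \<in> pverts H \<and> i < \<tau>} \<rparr>"

datatype ('a, 'b, 'c) mnode = First 'b | Mid "'a gnode" | Last 'c

text \<open>\<open>f\<close> assigns to each output of the first superconcentrator its node of the first copy
  of \<open>H\<close>, and \<open>g\<close> to each node of the third copy its input of the second one.\<close>

definition M_graph ::
  "nat \<Rightarrow> 'a pair_pre_digraph \<Rightarrow> 'b io_graph \<Rightarrow> 'c io_graph \<Rightarrow> ('b \<Rightarrow> 'a) \<Rightarrow> ('a \<Rightarrow> 'c) \<Rightarrow>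
   ('a gnode \<times> nat \<Rightarrow> 'a) \<Rightarrow> ('a, 'b, 'c) mnode io_graph" where
  "M_graph \<tau> H SC1 SC2 f g \<omega> = \<lparr>
     graph = \<lparr>
       pverts = First ` pverts (graph SC1) \<union> Mid ` pverts (G_graph \<tau> H \<omega>) \<union>
         Last ` pverts (graph SC2),
       parcs = map_prod First First ` parcs (graph SC1) \<union>
         map_prod Mid Mid ` parcs (G_graph \<tau> H \<omega>) \<union>
         map_prod Last Last ` parcs (graph SC2) \<union>
         {(First x, Mid (V1 (f x))) | x. x \<in> outputs SC1} \<union>
         {(Mid (V3 v), Last (g v)) | v. v \<in> pverts H} \<rparr>,
     inputs = First ` inputs SC1,
     outputs = Last ` outputs SC2 \<rparr>"

end

theory Submission
  imports Defs "HOL-Real_Asymp.Real_Asymp"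
begin

text \<open>Put \<open>L = \<lceil>sqrt n\<rceil>\<close>. Depth-robustness lets one extract greedily, from each of the three copies
  of \<open>H\<^sub>n\<close> minus the deleted set \<open>D\<close>, a family of \<open>m = \<Theta>(n / L)\<close> disjoint paths on \<open>2 L\<close>
  vertices. Call a path of one copy linked to a path of the next copy if some random edge goes from
  the second half of the former to the first half of the latter. Since indegrees are bounded, there
  are only \<open>2\<^bsup>O(n)\<^esup>\<close> pairs of path families, and as \<open>m * m \<le> n\<close> at most \<open>2\<^bsup>n\<^esup>\<close> ways to prescribe
  which paths are not linked. If many pairs are prescribed as not linked, \<open>\<Omega>(n)\<close> vertices have to avoid a set of
  \<open>\<Omega>(n)\<close> vertices with all their \<open>\<tau>\<close> samples, which has probability \<open>exp (- \<Omega>(\<tau> n))\<close>. Hence, for large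
  \<open>\<tau>\<close>, a union bound shows that with high probability most pairs are linked, for all path
  families at once. Then some path of the middle copy is linked to half of the paths on either side,
  and its midpoint is a hub: it is reached by \<open>\<Omega>(n)\<close> surviving vertices of the first copy and reaches
  \<open>\<Omega>(n)\<close> surviving vertices of the third. As \<open>card D + 1\<close> disjoint paths of a superconcentrator cannot
  all meet \<open>D\<close>, all but \<open>card D\<close> inputs reach the hub and all but \<open>card D\<close> outputs are reached
  from it.\<close>

section \<open>Disjoint paths in depth-robust graphs\<close>

text \<open>Deletion of \<open>D\<close> is a relation here, so that surviving walks are plain
  reflexive transitive closures. The closure relates even a deleted vertex to itself, which is why
  later statements keep endpoints out of \<open>D\<close> separately.\<close>

definition arcs_avoiding :: "('a \<times> 'a) set \<Rightarrow> 'a set \<Rightarrow> ('a \<times> 'a) set" where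
  "arcs_avoiding E D = {(x, y) \<in> E. x \<notin> D \<and> y \<notin> D}"

section \<open>Walks and paths as lists of vertices\<close>

lemma successively_rtrancl_nth:
  assumes "successively (\<lambda>x y. (x, y) \<in> E) xs" "i \<le> j" "j < length xs"
  shows "(xs ! i, xs ! j) \<in> E\<^sup>*"
  using assms
proof (induction xs arbitrary: i j)
  case Nil
  then show ?case by simp
next
  case (Cons x xs)
  show ?case
  proof (cases j)
    case 0
    then show ?thesis using Cons.prems by simp
  next
    case (Suc j')
    have len: "j' < length xs" and succ: "successively (\<lambda>x y. (x, y) \<in> E) xs"
      using Cons.prems Suc by (auto simp: successively_Cons)
    show ?thesis
    proof (cases i)
      case 0
      have "xs \<noteq> []" using len by auto
      then have "(x, xs ! 0) \<in> E"
        using Cons.prems(1) by (simp add: successively_Cons hd_conv_nth)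
      moreover have "(xs ! 0, xs ! j') \<in> E\<^sup>*"
        using Cons.IH[OF succ _ len] by simp
      ultimately show ?thesis using 0 Suc by (simp add: converse_rtrancl_into_rtrancl)
    next
      case (Suc i')
      then show ?thesis using Cons.IH[OF succ _ len, of i'] Cons.prems \<open>j = Suc j'\<close> by simp
    qed
  qed
qed

lemma (in wf_digraph) successively_awalk_verts:
  "awalk u p v \<Longrightarrow> successively (\<lambda>x y. (x, y) \<in> arcs_ends G) (awalk_verts u p)"
proof (induction p arbitrary: u)
  case Nil
  then show ?case by simp
next
  case (Cons e p)
  then have e: "e \<in> arcs G" and w: "awalk (head G e) p v"
    by (auto simp: awalk_Cons_iff)
  then have "hd (awalk_verts (head G e) p) = head G e" by auto
  with Cons.IH[OF w] e show ?case
    by (auto simp: successively_Cons arcs_ends_conv)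
qed

text \<open>Passage from arc lists to vertex lists. A path with \<open>d\<close> arcs has
  \<open>d + 1\<close> vertices, hence the bound \<open>2 * L\<close> \<le> \<open>d + 1\<close> in
  later hypotheses; from here on paths are measured in vertices.\<close>

lemma apath_del_verts_vertex_list:
  assumes "pair_wf_digraph G" "pre_digraph.apath (del_verts G D) u p v"
  defines "xs \<equiv> pre_digraph.awalk_verts (del_verts G D) u p"
  shows "length xs = Suc (length p)" "distinct xs" "set xs \<subseteq> pverts G - D"
    "successively (\<lambda>x y. (x, y) \<in> parcs G) xs"
proof -
  interpret pair_wf_digraph G by fact
  interpret I: wf_digraph "del_verts G D"
    using wf_digraph_axioms by (auto intro!: wellformed_induce_subgraph)
  have w: "I.awalk u p v" and d: "distinct xs"
    using assms by (auto simp: I.apath_def)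
  show "length xs = Suc (length p)" by (simp add: xs_def I.length_awalk_verts)
  show "distinct xs" by fact
  show "set xs \<subseteq> pverts G - D"
    using w unfolding I.awalk_conv xs_def induce_subgraph_verts by (elim conjE)
  have "arcs_ends (del_verts G D) \<subseteq> parcs G"
    by (auto simp: arcs_ends_conv)
  then show "successively (\<lambda>x y. (x, y) \<in> parcs G) xs"
    unfolding xs_def by - (rule successively_mono[OF I.successively_awalk_verts[OF w]], auto)
qed

section \<open>Counting paths and path families\<close>

definition vpaths :: "'a pair_pre_digraph \<Rightarrow> nat \<Rightarrow> 'a list set" where
  "vpaths G l = {xs. length xs = l \<and> distinct xs \<and> set xs \<subseteq> pverts G \<and>
     successively (\<lambda>x y. (x, y) \<in> parcs G) xs}"

lemma vpaths_take:
  assumes "xs \<in> vpaths G l" "l' \<le> l"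
  shows "take l' xs \<in> vpaths G l'"
proof -
  have "successively (\<lambda>x y. (x, y) \<in> parcs G) (take l' xs @ drop l' xs)"
    using assms by (simp add: vpaths_def)
  then have "successively (\<lambda>x y. (x, y) \<in> parcs G) (take l' xs)"
    by (simp only: successively_append_iff)
  then show ?thesis using assms by (auto simp: vpaths_def dest: in_set_takeD)
qed

lemma finite_vpaths: "finite (pverts G) \<Longrightarrow> finite (vpaths G l)"
  by (rule finite_subset[OF _ finite_lists_length_eq[of "pverts G" l]]) (auto simp: vpaths_def)

lemma card_in_neighbours_le:
  assumes "indegree_le k G" "v \<in> pverts G"
  shows "card {u. (u, v) \<in> parcs G} \<le> k"
proof -
  have "in_arcs (with_proj G) v = (\<lambda>u. (u, v)) ` {u. (u, v) \<in> parcs G}"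
    by (auto simp: in_arcs_def)
  then have "in_degree (with_proj G) v = card {u. (u, v) \<in> parcs G}"
    by (simp add: in_degree_def card_image inj_on_def)
  then show ?thesis using assms by (auto simp: indegree_le_def)
qed

text \<open>Only indegrees are bounded, so paths are built backwards: one of the vertices of
  \<open>G\<close> comes last, and each predecessor is one of at most \<open>k\<close> in-neighbours
  of the current head.\<close>

lemma card_vpaths_le:
  assumes "dag G" "indegree_le k G"
  shows "card (vpaths G (Suc l)) \<le> card (pverts G) * k ^ l"
proof -
  interpret pair_fin_digraph G using assms by (simp add: dag_def)
  show ?thesis
  proof (induction l)
    case 0
    have "vpaths G (Suc 0) \<subseteq> (\<lambda>x. [x]) ` pverts G"
      by (auto simp: vpaths_def length_Suc_conv)
    then show ?case
      using surj_card_le[OF pair_finite_verts] by simp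
  next
    case (Suc l)
    have fin: "finite {u. (u, v) \<in> parcs G}" for v
      by (rule finite_subset[OF _ pair_finite_verts]) (auto dest: in_arcsD1)
    have "vpaths G (Suc (Suc l)) \<subseteq>
        (\<Union>xs\<in>vpaths G (Suc l). (\<lambda>u. u # xs) ` {u. (u, hd xs) \<in> parcs G})" (is "_ \<subseteq> ?U")
    proof
      fix ys assume "ys \<in> vpaths G (Suc (Suc l))"
      moreover from this obtain u xs where "ys = u # xs" "xs \<noteq> []"
        by (auto simp: vpaths_def length_Suc_conv)
      ultimately show "ys \<in> ?U"
        by (auto simp: vpaths_def successively_Cons)
    qed
    then have "card (vpaths G (Suc (Suc l))) \<le> card ?U"
      by (rule card_mono[rotated]) (auto simp: finite_vpaths pair_finite_verts fin)
    also have "\<dots> \<le> (\<Sum>xs\<in>vpaths G (Suc l). card ((\<lambda>u. u # xs) ` {u. (u, hd xs) \<in> parcs G}))"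
      by (rule card_UN_le) (simp add: finite_vpaths pair_finite_verts)
    also have "\<dots> \<le> (\<Sum>xs\<in>vpaths G (Suc l). k)"
    proof (rule sum_mono)
      fix xs assume "xs \<in> vpaths G (Suc l)"
      then have "hd xs \<in> pverts G"
        by (cases xs) (auto simp: vpaths_def)
      then show "card ((\<lambda>u. u # xs) ` {u. (u, hd xs) \<in> parcs G}) \<le> k"
        using card_in_neighbours_le[OF assms(2)] card_image_le[OF fin] le_trans by blast
    qed
    also have "\<dots> = card (vpaths G (Suc l)) * k" by simp
    also have "\<dots> \<le> (card (pverts G) * k ^ l) * k"
      using Suc.IH by (rule mult_right_mono) simp
    finally show ?case by (simp add: mult_ac)
  qed
qed

text \<open>Each path has \<open>2 * L\<close> vertices so that \<open>take L\<close> and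
  \<open>drop L\<close> split it into equal halves, for arriving and departing links. The
  extensional function space makes the set of families finite and easy to count.\<close>

definition path_families :: "'a pair_pre_digraph \<Rightarrow> nat \<Rightarrow> nat \<Rightarrow> (nat \<Rightarrow> 'a list) set" where
  "path_families G L m =
     {Q \<in> {..<m} \<rightarrow>\<^sub>E vpaths G (2 * L). disjoint_family_on (\<lambda>i. set (Q i)) {..<m}}"

lemma path_familiesD:
  assumes "Q \<in> path_families G L m" "i < m"
  shows "length (Q i) = 2 * L" "distinct (Q i)" "set (Q i) \<subseteq> pverts G"
    "successively (\<lambda>x y. (x, y) \<in> parcs G) (Q i)"
  using assms by (auto simp: path_families_def vpaths_def PiE_iff)

lemma path_families_disjoint:
  assumes "Q \<in> path_families G L m" "i < m" "j < m" "i \<noteq> j"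
  shows "set (Q i) \<inter> set (Q j) = {}"
proof -
  have "disjoint_family_on (\<lambda>i. set (Q i)) {..<m}"
    using assms(1) by (simp add: path_families_def)
  from disjoint_family_onD[OF this] show ?thesis using assms(2-4) by simp
qed

text \<open>Greedy choice: deleting \<open>D\<close> together with the paths found so far stays
  within the budget \<open>e\<close>, so another long path survives; its first \<open>2 * L\<close>
  vertices extend the family.\<close>

lemma depth_robust_path_family:
  assumes "dag G" "depth_robust e d G" "D \<subseteq> pverts G"
    and "real (card D + 2 * L * m) \<le> e" "real (2 * L) \<le> d + 1"
  shows "\<exists>Q\<in>path_families G L m. \<forall>i<m. set (Q i) \<inter> D = {}"
  using assms(4)
proof (induction m)
  case 0
  then show ?case by (auto simp: path_families_def disjoint_family_on_def)
next
  case (Suc m)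
  interpret pair_fin_digraph G using assms by (simp add: dag_def)
  have "real (card D + 2 * L * m) \<le> e" using Suc.prems by simp
  from Suc.IH[OF this] obtain Q where Q: "Q \<in> path_families G L m" "\<forall>i<m. set (Q i) \<inter> D = {}"
    by blast
  define D' where "D' = D \<union> (\<Union>i<m. set (Q i))"
  have sub: "D' \<subseteq> pverts G"
    using assms(3) path_familiesD(3)[OF Q(1)] by (auto simp: D'_def)
  have "card (\<Union>i<m. set (Q i)) \<le> (\<Sum>i<m. card (set (Q i)))"
    by (rule card_UN_le) simp
  also have "\<dots> \<le> (\<Sum>i<m. 2 * L)"
    using path_familiesD(1)[OF Q(1)] by (intro sum_mono) (metis card_length lessThan_iff)
  finally have "card (\<Union>i<m. set (Q i)) \<le> 2 * L * m" by (simp add: mult_ac)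
  then have "card D' \<le> card D + 2 * L * m"
    unfolding D'_def using card_Un_le[of D "\<Union>i<m. set (Q i)"] by linarith
  then have "real (card D') \<le> real (card D + 2 * L * m)" by (simp only: of_nat_le_iff)
  also have "\<dots> \<le> e" using Suc.prems by simp
  finally obtain u p v where p: "pre_digraph.apath (del_verts G D') u p v" "d \<le> real (length p)"
    using assms(2) sub unfolding depth_robust_def by blast
  define xs where "xs = pre_digraph.awalk_verts (del_verts G D') u p"
  have xs: "length xs = Suc (length p)" "distinct xs" "set xs \<subseteq> pverts G - D'"
    "successively (\<lambda>x y. (x, y) \<in> parcs G) xs"
    using apath_del_verts_vertex_list[OF pair_wf_digraph_axioms p(1)] by (simp_all add: xs_def)
  have len: "2 * L \<le> length xs" using p(2) assms(5) xs(1) by linarith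
  define ys where "ys = take (2 * L) xs"
  have ys: "ys \<in> vpaths G (2 * L)"
    unfolding ys_def by (rule vpaths_take[OF _ len]) (use xs in \<open>auto simp: vpaths_def\<close>)
  have ysD: "set ys \<inter> D' = {}" using xs(3) by (auto simp: ys_def dest: in_set_takeD)
  have "Q(m := ys) \<in> {..<Suc m} \<rightarrow>\<^sub>E vpaths G (2 * L)"
    using Q(1) ys by (auto simp: path_families_def lessThan_Suc intro!: PiE_fun_upd)
  moreover have "disjoint_family_on (\<lambda>i. set ((Q(m := ys)) i)) {..<Suc m}"
    unfolding disjoint_family_on_def
  proof (intro ballI impI)
    fix i j assume ij: "i \<in> {..<Suc m}" "j \<in> {..<Suc m}" "i \<noteq> j"
    have "set (Q i) \<inter> set ys = {}" if "i < m" for i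
      using that ysD by (auto simp: D'_def)
    moreover have "set (Q i) \<inter> set (Q j) = {}" if "i < m" "j < m"
      by (rule path_families_disjoint[OF Q(1) that ij(3)])
    ultimately show "set ((Q(m := ys)) i) \<inter> set ((Q(m := ys)) j) = {}"
      using ij by (auto simp: less_Suc_eq)
  qed
  ultimately have "Q(m := ys) \<in> path_families G L (Suc m)"
    by (simp add: path_families_def)
  moreover have "\<forall>i<Suc m. set ((Q(m := ys)) i) \<inter> D = {}"
    using Q(2) ysD by (auto simp: less_Suc_eq D'_def)
  ultimately show ?case by blast
qed

text \<open>The choice of an end vertex costs a factor \<open>card (pverts G)\<close>, which is
  absorbed by \<open>2 ^ L\<close>. Thus a path has at most \<open>(2 * k\<^sup>2) ^ L\<close>
  choices, and \<open>m * L\<close> \<le> \<open>card (pverts G)\<close> makes the count of families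
  purely exponential, without a logarithm in the exponent.\<close>

lemma card_path_families_le:
  assumes "dag G" "indegree_le k G" "k \<ge> 1" "L \<ge> 1" "card (pverts G) \<le> 2 ^ L"
    "m * L \<le> card (pverts G)"
  shows "card (path_families G L m) \<le> (2 * k\<^sup>2) ^ card (pverts G)"
proof -
  interpret pair_fin_digraph G using assms by (simp add: dag_def)
  have "card (path_families G L m) \<le> card ({..<m} \<rightarrow>\<^sub>E vpaths G (2 * L))"
    by (rule card_mono) (auto simp: path_families_def finite_PiE finite_vpaths pair_finite_verts)
  also have "\<dots> = card (vpaths G (2 * L)) ^ m" by (simp add: card_PiE)
  also have "\<dots> \<le> ((2 * k\<^sup>2) ^ L) ^ m"
  proof (rule power_mono)
    have "card (vpaths G (2 * L)) \<le> card (pverts G) * k ^ (2 * L - 1)"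
      using card_vpaths_le[OF assms(1,2), of "2 * L - 1"] assms(4) by simp
    also have "\<dots> \<le> 2 ^ L * k ^ (2 * L)"
      using assms by (intro mult_mono power_increasing) auto
    finally show "card (vpaths G (2 * L)) \<le> (2 * k\<^sup>2) ^ L"
      by (simp add: power_mult power_mult_distrib)
  qed simp
  also have "\<dots> = (2 * k\<^sup>2) ^ (m * L)" by (metis power_mult mult.commute)
  also have "\<dots> \<le> (2 * k\<^sup>2) ^ card (pverts G)"
    using assms by (intro power_increasing) auto
  finally show ?thesis .
qed

section \<open>Random links between path families\<close>

lemma card_UN_take_path_family:
  assumes "Q \<in> path_families G L m" "I \<subseteq> {..<m}"
  shows "card (\<Union>i\<in>I. set (take L (Q i))) = card I * L"
proof -
  have "set (take L (Q i)) \<inter> set (take L (Q j)) = {}" if "i \<in> I" "j \<in> I" "i \<noteq> j" for i j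
  proof -
    have "set (Q i) \<inter> set (Q j) = {}"
      using that assms(2) by (intro path_families_disjoint[OF assms(1)]) auto
    then show ?thesis using set_take_subset[of L "Q i"] set_take_subset[of L "Q j"] by blast
  qed
  then have "card (\<Union>i\<in>I. set (take L (Q i))) = (\<Sum>i\<in>I. card (set (take L (Q i))))"
    using assms(2) finite_subset[OF assms(2)] by (intro card_UN_disjoint) auto
  also have "\<dots> = (\<Sum>i\<in>I. L)"
  proof (rule sum.cong[OF refl])
    fix i assume "i \<in> I"
    then have "i < m" using assms(2) by auto
    then show "card (set (take L (Q i))) = L"
      using path_familiesD(1,2)[OF assms(1), of i] by (simp add: distinct_card)
  qed
  finally show ?thesis by simp
qed

lemma card_UN_drop_path_family:
  assumes "Q \<in> path_families G L m" "I \<subseteq> {..<m}"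
  shows "card (\<Union>i\<in>I. set (drop L (Q i))) = card I * L"
proof -
  have "set (drop L (Q i)) \<inter> set (drop L (Q j)) = {}" if "i \<in> I" "j \<in> I" "i \<noteq> j" for i j
  proof -
    have "set (Q i) \<inter> set (Q j) = {}"
      using that assms(2) by (intro path_families_disjoint[OF assms(1)]) auto
    then show ?thesis using set_drop_subset[of L "Q i"] set_drop_subset[of L "Q j"] by blast
  qed
  then have "card (\<Union>i\<in>I. set (drop L (Q i))) = (\<Sum>i\<in>I. card (set (drop L (Q i))))"
    using assms(2) finite_subset[OF assms(2)] by (intro card_UN_disjoint) auto
  also have "\<dots> = (\<Sum>i\<in>I. L)"
  proof (rule sum.cong[OF refl])
    fix i assume "i \<in> I"
    then have "i < m" using assms(2) by auto
    then show "card (set (drop L (Q i))) = L"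
      using path_familiesD(1,2)[OF assms(1), of i] by (simp add: distinct_card)
  qed
  finally show ?thesis by simp
qed

text \<open>The samples at the vertices of \<open>Y\<close> are independent, and each misses its
  forbidden set with probability at most \<open>1 - \<eta>\<close> \<le>
  \<open>exp (- \<eta>)\<close>. There are \<open>card Y * \<tau>\<close> of them, and
  \<open>card Y\<close> is again at least \<eta> times the number of vertices, which gives the
  square of \<eta>.\<close>

lemma prob_samples_avoid_le:
  fixes G :: "'a pair_pre_digraph"
  assumes "finite (pverts G)" "pverts G \<noteq> {}" and W: "W = V2 \<or> W = V3"
    and Y: "Y \<subseteq> pverts G" "\<eta> * real (card (pverts G)) \<le> real (card Y)"
    and X: "\<And>y. y \<in> Y \<Longrightarrow> X y \<subseteq> pverts G"
      "\<And>y. y \<in> Y \<Longrightarrow> \<eta> * real (card (pverts G)) \<le> real (card (X y))"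
    and "0 \<le> \<eta>"
  shows "measure_pmf.prob (samples \<tau> G) {\<omega>. \<forall>y\<in>Y. \<forall>l<\<tau>. \<omega> (W y, l) \<notin> X y}
    \<le> exp (- (\<eta>\<^sup>2 * real \<tau> * real (card (pverts G))))"
proof -
  define n where "n = card (pverts G)"
  have n: "n > 0" using assms(1,2) by (simp add: n_def card_gt_0_iff)
  define A where "A = (V2 ` pverts G \<union> V3 ` pverts G) \<times> {..<\<tau>}"
  \<comment> \<open>\<open>B x\<close> is the set of admissible values at coordinate
    \<open>x\<close>. On \<open>A\<close> outside \<open>C\<close> it is everything, so the event
    lies in the product set \<open>Pi A B\<close>, whose probability factorises.\<close>
  define B where "B = (\<lambda>x :: 'a gnode \<times> nat. {a. \<forall>y l. x = (W y, l) \<and> y \<in> Y \<longrightarrow> a \<notin> X y})"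
  define C where "C = (W ` Y) \<times> {..<\<tau>}"
  have injW: "inj W" using W by (auto simp: inj_def)
  have finA: "finite A" using assms(1) by (simp add: A_def)
  have CA: "C \<subseteq> A" using W Y by (auto simp: C_def A_def)
  have factor: "measure_pmf.prob (pmf_of_set (pverts G)) (B x) \<le> (if x \<in> C then exp (- \<eta>) else 1)"
    if "x \<in> A" for x
  proof (cases "x \<in> C")
    case True
    then obtain y l where x: "x = (W y, l)" and y: "y \<in> Y" by (auto simp: C_def)
    have "card (pverts G \<inter> B x) \<le> card (pverts G - X y)"
      using assms(1) y by (intro card_mono) (auto simp: B_def x)
    also have "\<dots> = n - card (X y)"
      using X(1)[OF y] assms(1) by (simp add: card_Diff_subset finite_subset n_def)
    finally have "real (card (pverts G \<inter> B x)) \<le> real n - real (card (X y))"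
      using card_mono[OF assms(1) X(1)[OF y]] by (simp add: n_def)
    also have "\<dots> \<le> (1 - \<eta>) * real n"
      using X(2)[OF y] by (simp add: n_def algebra_simps)
    finally have "measure_pmf.prob (pmf_of_set (pverts G)) (B x) \<le> 1 - \<eta>"
      using assms(1,2) n by (simp add: measure_pmf_of_set n_def divide_le_eq)
    also have "\<dots> \<le> exp (- \<eta>)" using exp_ge_add_one_self[of "- \<eta>"] by simp
    finally show ?thesis using True by simp
  qed simp
  have "{\<omega>. \<forall>y\<in>Y. \<forall>l<\<tau>. \<omega> (W y, l) \<notin> X y} \<subseteq> Pi A B"
    by (auto simp: A_def B_def)
  then have "measure_pmf.prob (samples \<tau> G) {\<omega>. \<forall>y\<in>Y. \<forall>l<\<tau>. \<omega> (W y, l) \<notin> X y}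
      \<le> measure_pmf.prob (samples \<tau> G) (Pi A B)"
    by (intro measure_pmf.finite_measure_mono) auto
  also have "\<dots> = (\<Prod>x\<in>A. measure_pmf.prob (pmf_of_set (pverts G)) (B x))"
    unfolding samples_def A_def[symmetric] by (rule measure_Pi_pmf_Pi[OF finA])
  also have "\<dots> \<le> (\<Prod>x\<in>A. if x \<in> C then exp (- \<eta>) else 1)"
    using factor by (intro prod_mono) auto
  also have "\<dots> = (\<Prod>x\<in>C. exp (- \<eta>))"
    using CA finA by (simp add: prod.If_cases Int_absorb1)
  also have "\<dots> = exp (- \<eta>) ^ (card Y * \<tau>)"
    using injW by (simp add: C_def card_cartesian_product card_image inj_on_subset)
  also have "\<dots> = exp (- (\<eta> * real \<tau> * real (card Y)))"
    by (simp add: exp_of_nat_mult[symmetric] mult_ac)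
  also have "\<dots> \<le> exp (- (\<eta>\<^sup>2 * real \<tau> * real n))"
    using mult_left_mono[OF Y(2), of "\<eta> * real \<tau>"] \<open>0 \<le> \<eta>\<close>
    by (simp add: power2_eq_square n_def mult_ac)
  finally show ?thesis by (simp add: n_def)
qed

text \<open>Leaving from the second half and arriving in the first half means that the whole first
  half of \<open>p\<close> reaches the whole second half of \<open>q\<close>. The constructor
  \<open>W\<close> names the layer of the target: \<open>V2\<close> for links from the first copy,
  \<open>V3\<close> for links from the second.\<close>

definition linked ::
  "nat \<Rightarrow> ('a \<Rightarrow> 'a gnode) \<Rightarrow> ('a gnode \<times> nat \<Rightarrow> 'a) \<Rightarrow> nat \<Rightarrow> 'a list \<Rightarrow> 'a list \<Rightarrow> bool" where
  "linked \<tau> W \<omega> L p q \<longleftrightarrow> (\<exists>y\<in>set (take L q). \<exists>l<\<tau>. \<omega> (W y, l) \<in> set (drop L p))"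

text \<open>The failure event: for some pair of families, at least an eighth of the target paths
  each lack links from at least an eighth of the source paths. Quantifying over all families makes
  it independent of the deleted set.\<close>

definition poorly_linked ::
  "nat \<Rightarrow> ('a \<Rightarrow> 'a gnode) \<Rightarrow> 'a pair_pre_digraph \<Rightarrow> nat \<Rightarrow> nat \<Rightarrow> ('a gnode \<times> nat \<Rightarrow> 'a) set" where
  "poorly_linked \<tau> W G L m = {\<omega>. \<exists>Q\<in>path_families G L m. \<exists>P\<in>path_families G L m.
     m \<le> 8 * card {j \<in> {..<m}. m \<le> 8 * card {i \<in> {..<m}. \<not> linked \<tau> W \<omega> L (Q i) (P j)}}}"

text \<open>Union bound over triples of two families and a pattern \<open>T\<close> of missing
  links. Each family contributes \<open>(2 * k\<^sup>2) ^ n\<close> choices and the patterns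
  \<open>2 ^ (m * m)\<close> \<le> \<open>2 ^ n\<close>, since \<open>m\<close> \<le>
  \<open>L\<close>; the product is the factor \<open>(8 * k ^ 4) ^ n\<close>. A fixed pattern forces
  many samples to avoid large sets.\<close>

lemma prob_poorly_linked_le:
  fixes G :: "'a pair_pre_digraph"
  defines "n \<equiv> card (pverts G)"
  assumes "dag G" "indegree_le k G" "k \<ge> 1" "L \<ge> 1" "n \<ge> 1" "n \<le> 2 ^ L" "m * L \<le> n" "m \<le> L"
    and "0 \<le> \<eta>" "8 * \<eta> * real n \<le> real (m * L)" and W: "W = V2 \<or> W = V3"
  shows "measure_pmf.prob (samples \<tau> G) (poorly_linked \<tau> W G L m)
    \<le> (8 * real k ^ 4) ^ n * exp (- (\<eta>\<^sup>2 * real \<tau> * real n))"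
proof -
  interpret pair_fin_digraph G using assms by (simp add: dag_def)
  define F where "F = path_families G L m"
  define TT where "TT = {..<m} \<rightarrow>\<^sub>E Pow {..<m}"
  define J where "J = (\<lambda>T::nat \<Rightarrow> nat set. {j \<in> {..<m}. m \<le> 8 * card (T j)})"
  define Y where "Y = (\<lambda>P T. \<Union>j\<in>J T. set (take L (P j :: 'a list)))"
  \<comment> \<open>The vertices that the samples at \<open>y\<close> must miss. As the paths of a
    family are disjoint, at most one \<open>j\<close> contributes; the union spares choosing
    it.\<close>
  define X where "X = (\<lambda>Q P T y. \<Union>j\<in>{j \<in> J T. y \<in> set (take L (P j :: 'a list))}.
     \<Union>i\<in>T j. set (drop L (Q i :: 'a list)))"
  define Ev where "Ev = (\<lambda>(Q, P, T). {\<omega>. \<forall>y\<in>Y P T. \<forall>l<\<tau>. \<omega> (W y, l) \<notin> X Q P T y})"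
  define Z where "Z = {(Q, P, T) \<in> F \<times> F \<times> TT. m \<le> 8 * card (J T)}"
  have finF: "finite F"
    by (rule finite_subset[of _ "{..<m} \<rightarrow>\<^sub>E vpaths G (2 * L)"])
       (auto simp: F_def path_families_def finite_PiE finite_vpaths pair_finite_verts)
  have finTT: "finite TT" by (simp add: TT_def finite_PiE)
  have finZ: "finite Z"
    by (rule finite_subset[of _ "F \<times> F \<times> TT"]) (auto simp: Z_def finF finTT)
  have prob_Ev: "measure_pmf.prob (samples \<tau> G) (Ev z) \<le> exp (- (\<eta>\<^sup>2 * real \<tau> * real n))"
    if "z \<in> Z" for z
  proof -
    obtain Q P T where z: "z = (Q, P, T)" by (cases z) auto
    have Q: "Q \<in> path_families G L m" and P: "P \<in> path_families G L m" and T: "T \<in> TT"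
      and J8: "m \<le> 8 * card (J T)"
      using that by (auto simp: z Z_def F_def)
    \<comment> \<open>An eighth of the paths, counted with \<open>L\<close> vertices each, covers at
      least the fraction \<eta> of all vertices. This bounds both \<open>Y\<close> and the sets
      \<open>X\<close>.\<close>
    have big: "\<eta> * real n \<le> real (a * L)" if "m \<le> 8 * a" for a
    proof -
      have "8 * (\<eta> * real n) \<le> real (m * L)" using assms by simp
      also have "\<dots> \<le> real (8 * a * L)" using that by (intro of_nat_mono mult_right_mono) auto
      finally show ?thesis by simp
    qed
    have Jm: "J T \<subseteq> {..<m}" by (auto simp: J_def)
    have Tm: "T j \<subseteq> {..<m}" if "j \<in> J T" for j
      using T that by (auto simp: TT_def J_def)
    have Xsub: "X Q P T y \<subseteq> pverts G" for y
    proof -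
      have "set (drop L (Q i)) \<subseteq> pverts G" if "j \<in> J T" "i \<in> T j" for i j
        using path_familiesD(3)[OF Q, of i] set_drop_subset[of L "Q i"] Tm[OF that(1)] that(2)
        by auto
      then show ?thesis by (auto simp: X_def)
    qed
    show ?thesis
      unfolding z Ev_def prod.case n_def
    proof (rule prob_samples_avoid_le[OF pair_finite_verts _ W])
      show "pverts G \<noteq> {}" using assms by auto
      show "Y P T \<subseteq> pverts G"
      proof -
        have "set (take L (P j)) \<subseteq> pverts G" if "j \<in> J T" for j
          using path_familiesD(3)[OF P, of j] set_take_subset[of L "P j"] Jm that by auto
        then show ?thesis by (auto simp: Y_def)
      qed
      show "\<eta> * real (card (pverts G)) \<le> real (card (Y P T))"
        using big[OF J8] card_UN_take_path_family[OF P Jm] by (simp add: Y_def n_def)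
      show "X Q P T y \<subseteq> pverts G" for y by (rule Xsub)
      show "\<eta> * real (card (pverts G)) \<le> real (card (X Q P T y))" if y: "y \<in> Y P T" for y
      proof -
        obtain j where j: "j \<in> J T" "y \<in> set (take L (P j))" using y by (auto simp: Y_def)
        have "(\<Union>i\<in>T j. set (drop L (Q i))) \<subseteq> X Q P T y" using j by (auto simp: X_def)
        then have "card (T j) * L \<le> card (X Q P T y)"
          using card_UN_drop_path_family[OF Q Tm[OF j(1)]]
            card_mono[OF finite_subset[OF Xsub pair_finite_verts]] by metis
        moreover have "\<eta> * real n \<le> real (card (T j) * L)"
          using j(1) by (intro big) (auto simp: J_def)
        ultimately show ?thesis by (simp add: n_def del: of_nat_mult)
      qed
      show "0 \<le> \<eta>" by fact
    qed
  qed
  have "poorly_linked \<tau> W G L m \<subseteq> (\<Union>z\<in>Z. Ev z)"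
  proof
    fix \<omega> assume "\<omega> \<in> poorly_linked \<tau> W G L m"
    then obtain Q P where Q: "Q \<in> F" and P: "P \<in> F" and bad:
      "m \<le> 8 * card {j \<in> {..<m}. m \<le> 8 * card {i \<in> {..<m}. \<not> linked \<tau> W \<omega> L (Q i) (P j)}}"
      by (auto simp: poorly_linked_def F_def)
    \<comment> \<open>The pattern recorded is exactly the set of links missing in \<omega>; the
      restriction to indices below \<open>m\<close> puts it into \<open>TT\<close>.\<close>
    define T where "T = (\<lambda>j\<in>{..<m}. {i \<in> {..<m}. \<not> linked \<tau> W \<omega> L (Q i) (P j)})"
    have "T \<in> TT" by (auto simp: T_def TT_def)
    moreover have "J T = {j \<in> {..<m}. m \<le> 8 * card {i \<in> {..<m}. \<not> linked \<tau> W \<omega> L (Q i) (P j)}}"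
      unfolding J_def T_def by (intro Collect_cong conj_cong) auto
    ultimately have "(Q, P, T) \<in> Z" using Q P bad by (auto simp: Z_def)
    moreover have "\<omega> \<in> Ev (Q, P, T)"
      by (auto simp: Ev_def X_def T_def J_def linked_def)
    ultimately show "\<omega> \<in> (\<Union>z\<in>Z. Ev z)" by blast
  qed
  then have "measure_pmf.prob (samples \<tau> G) (poorly_linked \<tau> W G L m)
      \<le> measure_pmf.prob (samples \<tau> G) (\<Union>z\<in>Z. Ev z)"
    by (intro measure_pmf.finite_measure_mono) auto
  also have "\<dots> \<le> (\<Sum>z\<in>Z. measure_pmf.prob (samples \<tau> G) (Ev z))"
    by (rule measure_pmf.finite_measure_subadditive_finite[OF finZ]) auto
  also have "\<dots> \<le> (\<Sum>z\<in>Z. exp (- (\<eta>\<^sup>2 * real \<tau> * real n)))"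
    by (rule sum_mono) (rule prob_Ev)
  also have "\<dots> = real (card Z) * exp (- (\<eta>\<^sup>2 * real \<tau> * real n))" by simp
  also have "\<dots> \<le> (8 * real k ^ 4) ^ n * exp (- (\<eta>\<^sup>2 * real \<tau> * real n))"
  proof (rule mult_right_mono)
    have "card TT = 2 ^ (m * m)" by (simp add: TT_def card_PiE card_Pow power_mult)
    also have "\<dots> \<le> 2 ^ n"
      using assms by (intro power_increasing) (auto intro: order_trans[OF mult_le_mono2[of m L m]])
    finally have cT: "card TT \<le> 2 ^ n" .
    have cF: "card F \<le> (2 * k\<^sup>2) ^ n"
      unfolding F_def n_def using assms by (intro card_path_families_le) auto
    have "card Z \<le> card (F \<times> F \<times> TT)"
      by (rule card_mono) (auto simp: Z_def finF finTT)
    also have "\<dots> = card F * (card F * card TT)" by (simp add: card_cartesian_product)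
    also have "\<dots> \<le> (2 * k\<^sup>2) ^ n * ((2 * k\<^sup>2) ^ n * 2 ^ n)"
      using cT cF by (intro mult_le_mono)
    also have "\<dots> = (2 * k\<^sup>2 * (2 * k\<^sup>2 * 2)) ^ n" by (simp only: power_mult_distrib)
    also have "2 * k\<^sup>2 * (2 * k\<^sup>2 * 2) = 8 * k ^ 4" by (simp add: power2_eq_square power4_eq_xxxx)
    finally have "real (card Z) \<le> real ((8 * k ^ 4) ^ n)" by (simp only: of_nat_le_iff)
    then show "real (card Z) \<le> (8 * real k ^ 4) ^ n" by simp
  qed simp
  finally show ?thesis .
qed

section \<open>The hub\<close>

text \<open>Used to carry surviving walks from a component into a larger graph: a copy of
  \<open>G\<close> into \<open>G_graph\<close>, and \<open>G_graph\<close> or a superconcentrator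
  into \<open>M_graph\<close>. Deleted vertices are pulled back along the embedding.\<close>

lemma arcs_avoiding_rtrancl_map:
  assumes "(x, y) \<in> (arcs_avoiding E (f -` D))\<^sup>*"
    and "\<And>a b. (a, b) \<in> E \<Longrightarrow> (f a, f b) \<in> E'"
  shows "(f x, f y) \<in> (arcs_avoiding E' D)\<^sup>*"
  using assms(1)
proof (induction rule: rtrancl_induct)
  case (step y z)
  then have "(f y, f z) \<in> arcs_avoiding E' D"
    using assms(2) by (auto simp: arcs_avoiding_def)
  with step.IH show ?case by (rule rtrancl_into_rtrancl)
qed simp

lemma arcs_avoiding_rtrancl_notin:
  assumes "(x, y) \<in> (arcs_avoiding E D)\<^sup>*" "x \<notin> D"
  shows "y \<notin> D"
  using assms by (induction rule: rtrancl_induct) (auto simp: arcs_avoiding_def)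

lemma successively_arcs_avoiding:
  assumes "successively (\<lambda>x y. (x, y) \<in> E) xs" "set xs \<inter> D = {}" "i \<le> j" "j < length xs"
  shows "(xs ! i, xs ! j) \<in> (arcs_avoiding E D)\<^sup>*"
proof (rule successively_rtrancl_nth[OF _ assms(3,4)])
  show "successively (\<lambda>x y. (x, y) \<in> arcs_avoiding E D) xs"
    using assms(1) by (rule successively_mono) (use assms(2) in \<open>auto simp: arcs_avoiding_def\<close>)
qed

lemma vimage_card_le:
  assumes "inj f" "finite D"
  shows "card (f -` D) \<le> card D"
  using card_vimage_inj_on_le[OF assms] by simp

text \<open>Double counting: both hypotheses together leave few unrelated pairs, so that some middle
  index is related to at least half of the indices on either side.\<close>

lemma exists_well_linked_middle:
  fixes R1 R2 :: "nat \<Rightarrow> nat \<Rightarrow> bool"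
  assumes "8 * card {j \<in> {..<m}. m \<le> 8 * card {i \<in> {..<m}. \<not> R1 i j}} < m"
    and "8 * card {l \<in> {..<m}. m \<le> 8 * card {j \<in> {..<m}. \<not> R2 j l}} < m"
  shows "\<exists>j<m. m \<le> 2 * card {i \<in> {..<m}. R1 i j} \<and> m \<le> 2 * card {l \<in> {..<m}. R2 j l}"
proof (rule ccontr)
  assume contra: "\<not> ?thesis"
  define J1 where "J1 = {j \<in> {..<m}. m \<le> 8 * card {i \<in> {..<m}. \<not> R1 i j}}"
  define J2 where "J2 = {l \<in> {..<m}. m \<le> 8 * card {j \<in> {..<m}. \<not> R2 j l}}"
  have compl: "card {i \<in> {..<m}. P i} + card {i \<in> {..<m}. \<not> P i} = m" for P
  proof -
    have "card ({i \<in> {..<m}. P i} \<union> {i \<in> {..<m}. \<not> P i}) =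
        card {i \<in> {..<m}. P i} + card {i \<in> {..<m}. \<not> P i}"
      by (rule card_Un_disjoint) auto
    moreover have "{i \<in> {..<m}. P i} \<union> {i \<in> {..<m}. \<not> P i} = {..<m}" by auto
    ultimately show ?thesis by simp
  qed
  have J12: "J1 \<subseteq> {..<m}" "J2 \<subseteq> {..<m}" by (auto simp: J1_def J2_def)
  \<comment> \<open>A \<open>j\<close> outside \<open>J1\<close> satisfies the \<open>R1\<close>
    half of the claim with room to spare, so by the negated goal it must fail the \<open>R2\<close>
    half.\<close>
  have many: "m \<le> 2 * card {l \<in> {..<m}. \<not> R2 j l}" if j: "j \<in> {..<m} - J1" for j
  proof -
    have "8 * card {i \<in> {..<m}. \<not> R1 i j} < m" using j by (auto simp: J1_def)
    then have "m \<le> 2 * card {i \<in> {..<m}. R1 i j}" using compl[of "\<lambda>i. R1 i j"] by linarith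
    then have "\<not> m \<le> 2 * card {l \<in> {..<m}. R2 j l}" using contra j by auto
    then show ?thesis using compl[of "R2 j"] by linarith
  qed
  \<comment> \<open>The pairs violating \<open>R2\<close> are counted by rows and by
    columns.\<close>
  have "(\<Sum>j<m. card {l \<in> {..<m}. \<not> R2 j l}) = (\<Sum>j<m. \<Sum>l<m. if \<not> R2 j l then 1 else 0)"
    by (simp add: sum.If_cases Int_def)
  also have "\<dots> = (\<Sum>l<m. \<Sum>j<m. if \<not> R2 j l then 1 else 0)" by (rule sum.swap)
  also have "\<dots> = (\<Sum>l<m. card {j \<in> {..<m}. \<not> R2 j l})"
    by (simp add: sum.If_cases Int_def)
  finally have swap: "(\<Sum>j<m. card {l \<in> {..<m}. \<not> R2 j l}) =
    (\<Sum>l<m. card {j \<in> {..<m}. \<not> R2 j l})" (is "?A = ?B") .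
  have "(m - card J1) * m = (\<Sum>j\<in>{..<m} - J1. m)"
    using J12 by (simp add: card_Diff_subset finite_subset)
  also have "\<dots> \<le> (\<Sum>j\<in>{..<m} - J1. 2 * card {l \<in> {..<m}. \<not> R2 j l})"
    by (rule sum_mono) (rule many)
  also have "\<dots> \<le> (\<Sum>j<m. 2 * card {l \<in> {..<m}. \<not> R2 j l})"
    by (rule sum_mono2) auto
  finally have low: "(m - card J1) * m \<le> 2 * ?A" by (simp add: sum_distrib_left)
  \<comment> \<open>Columns outside \<open>J2\<close> contain fewer than \<open>m / 8\<close>
    violations, and the fewer than \<open>m / 8\<close> columns in \<open>J2\<close> at most
    \<open>m\<close> each. So at most a quarter of all pairs violate \<open>R2\<close>.\<close>
  have "8 * ?B = (\<Sum>l<m. 8 * card {j \<in> {..<m}. \<not> R2 j l})" by (simp add: sum_distrib_left)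
  also have "\<dots> \<le> (\<Sum>l<m. m + (if l \<in> J2 then 8 * m else 0))"
  proof (rule sum_mono)
    fix l assume l: "l \<in> {..<m}"
    have "card {j \<in> {..<m}. \<not> R2 j l} \<le> m" using compl[of "\<lambda>j. R2 j l"] by linarith
    then show "8 * card {j \<in> {..<m}. \<not> R2 j l} \<le> m + (if l \<in> J2 then 8 * m else 0)"
      using l by (auto simp: J2_def)
  qed
  also have "\<dots> = m * m + 8 * card J2 * m"
    using J12 by (simp add: sum.distrib sum.If_cases Int_absorb1 mult_ac)
  also have "\<dots> \<le> 2 * (m * m)"
    using assms(2) mult_le_mono1[of "8 * card J2" m m] by (simp add: J2_def)
  finally have up: "8 * ?A \<le> 2 * (m * m)" using swap by simp
  have m: "m > 0" using assms(1) by simp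
  \<comment> \<open>More than three quarters of the rows are at least half violations, which is more
    than a quarter of all pairs.\<close>
  have "3 * m < 4 * (m - card J1)" using assms(1) unfolding J1_def by linarith
  then have "3 * m * m < 4 * (m - card J1) * m" using m by simp
  also have "\<dots> \<le> 8 * ?A" using low by (simp add: mult.commute)
  also have "\<dots> \<le> 2 * (m * m)" by (rule up)
  finally show False by simp
qed

lemma G_graph_copy_arcs:
  assumes "W = V1 \<or> W = V2 \<or> W = V3" "(x, y) \<in> parcs G"
  shows "(W x, W y) \<in> parcs (G_graph \<tau> G \<omega>)"
  using assms by (auto simp: G_graph_def image_iff map_prod_def split: prod.splits)

lemma linkedE:
  assumes "linked \<tau> W \<omega> L p q" "length p = 2 * L" "length q = 2 * L"
  obtains i j l where "i < L" "j < L" "l < \<tau>" "\<omega> (W (q ! i), l) = p ! (L + j)"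
proof -
  obtain y l where y: "y \<in> set (take L q)" "l < \<tau>" "\<omega> (W y, l) \<in> set (drop L p)"
    using assms(1) by (auto simp: linked_def)
  obtain i where i: "i < L" "y = q ! i"
    using y(1) assms(3) by (auto simp: in_set_conv_nth)
  obtain j where "j < L" "\<omega> (W y, l) = p ! (L + j)"
    using y(3) assms(2) by (auto simp: in_set_conv_nth)
  then show ?thesis using that i y(2) by blast
qed

text \<open>Depth-robustness gives a family avoiding \<open>D\<close> in each copy, and double
  counting gives a middle path linked to half of the paths on either side. Each linked path
  contributes a half of \<open>L\<close> vertices, hence the bound \<open>m * L\<close> \<le>
  \<open>2 * card\<close> on both sides.\<close>

lemma exists_hub:
  assumes "dag G" "depth_robust e d G"
    and "\<omega> \<notin> poorly_linked \<tau> V2 G L m" "\<omega> \<notin> poorly_linked \<tau> V3 G L m"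
    and "finite D" "real (card D + 2 * L * m) \<le> e" "real (2 * L) \<le> d + 1" "L \<ge> 1"
  defines "E \<equiv> arcs_avoiding (parcs (G_graph \<tau> G \<omega>)) D"
  shows "\<exists>z\<in>pverts G. V2 z \<notin> D \<and>
    m * L \<le> 2 * card {x \<in> pverts G. V1 x \<notin> D \<and> (V1 x, V2 z) \<in> E\<^sup>*} \<and>
    m * L \<le> 2 * card {x \<in> pverts G. V3 x \<notin> D \<and> (V2 z, V3 x) \<in> E\<^sup>*}"
proof -
  interpret pair_fin_digraph G using assms by (simp add: dag_def)
  have family: "\<exists>Q\<in>path_families G L m. \<forall>i<m. set (Q i) \<inter> (W -` D \<inter> pverts G) = {}"
    if W: "W = V1 \<or> W = V2 \<or> W = V3" for W
  proof (rule depth_robust_path_family[OF assms(1,2)])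
    have "inj W" using W by (auto simp: inj_def)
    then have "card (W -` D \<inter> pverts G) \<le> card D"
      using card_vimage_inj_on_le[of W "pverts G" D] assms(5) by (simp add: inj_on_subset)
    then have "real (card (W -` D \<inter> pverts G) + 2 * L * m) \<le> real (card D + 2 * L * m)"
      by (simp only: of_nat_le_iff add_le_cancel_right)
    also have "\<dots> \<le> e" by fact
    finally show "real (card (W -` D \<inter> pverts G) + 2 * L * m) \<le> e" .
  qed (use assms in auto)
  obtain Q where Q: "Q \<in> path_families G L m" "\<forall>i<m. set (Q i) \<inter> (V1 -` D \<inter> pverts G) = {}"
    using family[of V1] by auto
  obtain P where P: "P \<in> path_families G L m" "\<forall>i<m. set (P i) \<inter> (V2 -` D \<inter> pverts G) = {}"
    using family[of V2] by auto
  obtain R where R: "R \<in> path_families G L m" "\<forall>i<m. set (R i) \<inter> (V3 -` D \<inter> pverts G) = {}"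
    using family[of V3] by auto
  have notin: "W (F i ! a) \<notin> D" "F i ! a \<in> pverts G"
    if "F \<in> path_families G L m" "\<forall>i<m. set (F i) \<inter> (W -` D \<inter> pverts G) = {}" "i < m" "a < 2 * L"
    for W F i a
  proof -
    have "F i ! a \<in> set (F i)" using path_familiesD(1)[OF that(1,3)] that(4) by simp
    moreover show "F i ! a \<in> pverts G" using calculation path_familiesD(3)[OF that(1,3)] by auto
    ultimately show "W (F i ! a) \<notin> D" using that(2,3) by auto
  qed
  have along: "(W (F i ! a), W (F i ! b)) \<in> E\<^sup>*"
    if W: "W = V1 \<or> W = V2 \<or> W = V3" and F: "F \<in> path_families G L m"
      "\<forall>i<m. set (F i) \<inter> (W -` D \<inter> pverts G) = {}" and i: "i < m" and ab: "a \<le> b" "b < 2 * L"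
    for W F i a b
    unfolding E_def
  proof (rule arcs_avoiding_rtrancl_map[where f = W and E = "parcs G"])
    have "set (F i) \<inter> W -` D = {}" using F(2) i path_familiesD(3)[OF F(1) i] by auto
    then show "(F i ! a, F i ! b) \<in> (arcs_avoiding (parcs G) (W -` D))\<^sup>*"
      using path_familiesD(1,4)[OF F(1) i] ab by (intro successively_arcs_avoiding) auto
  qed (rule G_graph_copy_arcs[OF W])
  have "8 * card {j \<in> {..<m}. m \<le> 8 * card {i \<in> {..<m}. \<not> linked \<tau> V2 \<omega> L (Q i) (P j)}} < m"
    using assms(3) Q(1) P(1) unfolding poorly_linked_def by (auto simp: not_le)
  moreover have "8 * card {l \<in> {..<m}. m \<le> 8 * card {j \<in> {..<m}. \<not> linked \<tau> V3 \<omega> L (P j) (R l)}} < m"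
    using assms(4) P(1) R(1) unfolding poorly_linked_def by (auto simp: not_le)
  ultimately obtain j where j: "j < m"
    and I: "m \<le> 2 * card {i \<in> {..<m}. linked \<tau> V2 \<omega> L (Q i) (P j)}" (is "_ \<le> 2 * card ?I")
    and K: "m \<le> 2 * card {l \<in> {..<m}. linked \<tau> V3 \<omega> L (P j) (R l)}" (is "_ \<le> 2 * card ?K")
    using exists_well_linked_middle[of m "\<lambda>i j. linked \<tau> V2 \<omega> L (Q i) (P j)"
        "\<lambda>j l. linked \<tau> V3 \<omega> L (P j) (R l)"] by auto
  \<comment> \<open>Links into \<open>P j\<close> arrive at positions below \<open>L\<close> and
    links out of it depart from positions at or above \<open>L\<close>, so this one vertex serves
    both directions.\<close>
  define z where "z = P j ! L"
  have z: "z \<in> pverts G" "V2 z \<notin> D" using notin[OF P j, of L] assms(8) by (auto simp: z_def)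
  have "(\<Union>i\<in>?I. set (take L (Q i))) \<subseteq> {x \<in> pverts G. V1 x \<notin> D \<and> (V1 x, V2 z) \<in> E\<^sup>*}" (is "_ \<subseteq> ?A")
  proof
    fix x assume "x \<in> (\<Union>i\<in>?I. set (take L (Q i)))"
    then obtain i where i: "i < m" "linked \<tau> V2 \<omega> L (Q i) (P j)" "x \<in> set (take L (Q i))" by auto
    have len: "length (Q i) = 2 * L" "length (P j) = 2 * L"
      by (simp_all add: path_familiesD(1)[OF Q(1) i(1)] path_familiesD(1)[OF P(1) j])
    obtain a where a: "a < L" "x = Q i ! a" using i(3) len by (auto simp: in_set_conv_nth)
    obtain b c l where l: "b < L" "c < L" "l < \<tau>" "\<omega> (V2 (P j ! b), l) = Q i ! (L + c)"
      using linkedE[OF i(2) len] by metis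
    have "(V1 (Q i ! a), V1 (Q i ! (L + c))) \<in> E\<^sup>*"
      using a l by (intro along[OF _ Q i(1)]) auto
    also have "(V1 (Q i ! (L + c)), V2 (P j ! b)) \<in> E"
    proof -
      have "P j ! b \<in> pverts G" "V2 (P j ! b) \<notin> D" "V1 (Q i ! (L + c)) \<notin> D"
        using notin[OF P j, of b] notin(1)[OF Q i(1), of "L + c"] l by auto
      then show ?thesis using l unfolding E_def arcs_avoiding_def G_graph_def by fastforce
    qed
    also (rtrancl_into_rtrancl) have "(V2 (P j ! b), V2 z) \<in> E\<^sup>*"
      unfolding z_def using l by (intro along[OF _ P j]) auto
    finally show "x \<in> ?A" using a notin[OF Q i(1), of a] by auto
  qed
  then have "card (\<Union>i\<in>?I. set (take L (Q i))) \<le> card ?A"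
    by (rule card_mono[rotated]) (simp add: pair_finite_verts)
  moreover have "?I \<subseteq> {..<m}" by blast
  ultimately have "card ?I * L \<le> card ?A"
    by (simp only: card_UN_take_path_family[OF Q(1)])
  then have mA: "m * L \<le> 2 * card ?A"
    using mult_le_mono1[OF I, of L] by linarith
  have "(\<Union>l\<in>?K. set (drop L (R l))) \<subseteq> {x \<in> pverts G. V3 x \<notin> D \<and> (V2 z, V3 x) \<in> E\<^sup>*}"
    (is "_ \<subseteq> ?B")
  proof
    fix x assume "x \<in> (\<Union>l\<in>?K. set (drop L (R l)))"
    then obtain i where i: "i < m" "linked \<tau> V3 \<omega> L (P j) (R i)" "x \<in> set (drop L (R i))" by auto
    have len: "length (P j) = 2 * L" "length (R i) = 2 * L"
      by (simp_all add: path_familiesD(1)[OF R(1) i(1)] path_familiesD(1)[OF P(1) j])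
    obtain a where a: "a < L" "x = R i ! (L + a)" using i(3) len by (auto simp: in_set_conv_nth)
    obtain b c l where l: "b < L" "c < L" "l < \<tau>" "\<omega> (V3 (R i ! b), l) = P j ! (L + c)"
      using linkedE[OF i(2) len] by metis
    have "(V2 z, V2 (P j ! (L + c))) \<in> E\<^sup>*"
      unfolding z_def using l by (intro along[OF _ P j]) auto
    also have "(V2 (P j ! (L + c)), V3 (R i ! b)) \<in> E"
    proof -
      have "R i ! b \<in> pverts G" "V3 (R i ! b) \<notin> D" "V2 (P j ! (L + c)) \<notin> D"
        using notin[OF R i(1), of b] notin(1)[OF P j, of "L + c"] l by auto
      then show ?thesis using l unfolding E_def arcs_avoiding_def G_graph_def by fastforce
    qed
    also (rtrancl_into_rtrancl) have "(V3 (R i ! b), V3 (R i ! (L + a))) \<in> E\<^sup>*"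
      using a l by (intro along[OF _ R i(1)]) auto
    finally show "x \<in> ?B" using a notin[OF R i(1), of "L + a"] by auto
  qed
  then have "card (\<Union>i\<in>?K. set (drop L (R i))) \<le> card ?B"
    by (rule card_mono[rotated]) (simp add: pair_finite_verts)
  moreover have "?K \<subseteq> {..<m}" by blast
  ultimately have "card ?K * L \<le> card ?B"
    by (simp only: card_UN_drop_path_family[OF R(1)])
  then have "m * L \<le> 2 * card ?B"
    using mult_le_mono1[OF K, of L] by linarith
  with mA show ?thesis using z by blast
qed

section \<open>Connecting the superconcentrators\<close>

text \<open>Pigeonhole on \<open>card D + 1\<close> vertex-disjoint paths: choosing a deleted vertex
  on each of them would inject too large a set into \<open>D\<close>.\<close>

lemma superconcentrator_path_avoiding:
  assumes "superconcentrator n X" "A \<subseteq> inputs X" "B \<subseteq> outputs X"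
    and "finite D" "card D < card A" "card D < card B"
  shows "\<exists>a\<in>A. \<exists>b\<in>B. a \<notin> D \<and> (a, b) \<in> (arcs_avoiding (parcs (graph X)) D)\<^sup>*"
proof -
  let ?G = "with_proj (graph X)"
  have io: "io_dag n X" using assms(1) by (simp add: superconcentrator_def)
  then have X: "pair_fin_digraph (graph X)" by (simp add: io_dag_def dag_def)
  interpret wf_digraph ?G
    using X by (simp add: pair_fin_digraph_def wf_digraph_wp_iff)
  have "finite (inputs X)"
    using io pair_fin_digraph.pair_finite_verts[OF X] by (auto simp: io_dag_def intro: finite_subset)
  then have "card A \<le> n" using card_mono[OF _ assms(2)] io by (simp add: io_dag_def)
  define r where "r = Suc (card D)"
  have r: "1 \<le> r" "r \<le> n" using assms(5) \<open>card A \<le> n\<close> by (auto simp: r_def)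
  have rAB: "r \<le> card A" "r \<le> card B" using assms(5,6) by (simp_all add: r_def)
  obtain A' where A': "A' \<subseteq> A" "card A' = r"
    using obtain_subset_with_card_n[of r A] rAB(1) by blast
  obtain B' where B': "B' \<subseteq> B" "card B' = r"
    using obtain_subset_with_card_n[of r B] rAB(2) by blast
  have "A' \<subseteq> inputs X" "B' \<subseteq> outputs X" using A'(1) B'(1) assms(2,3) by blast+
  then have hyp: "1 \<le> r \<and> r \<le> n \<and> A' \<subseteq> inputs X \<and> card A' = r \<and> B' \<subseteq> outputs X \<and> card B' = r"
    using r A'(2) B'(2) by blast
  from conjunct2[OF assms(1)[unfolded superconcentrator_def], THEN spec, THEN spec, THEN spec,
      THEN mp, OF hyp]
  obtain u p v where
    path: "\<forall>i<r. apath (u i) (p i) (v i) \<and> u i \<in> A' \<and> v i \<in> B'" and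
    disj: "\<forall>i<r. \<forall>j<r. i \<noteq> j \<longrightarrow>
       set (awalk_verts (u i) (p i)) \<inter> set (awalk_verts (u j) (p j)) = {}"
    by (elim exE conjE)
  have "\<exists>i<r. set (awalk_verts (u i) (p i)) \<inter> D = {}"
  proof (rule ccontr)
    assume "\<not> ?thesis"
    then have "\<forall>i\<in>{..<r}. \<exists>x. x \<in> set (awalk_verts (u i) (p i)) \<inter> D" by blast
    then obtain h where h: "\<And>i. i < r \<Longrightarrow> h i \<in> set (awalk_verts (u i) (p i)) \<inter> D"
      by (metis lessThan_iff)
    have "inj_on h {..<r}"
    proof (rule inj_onI, rule ccontr)
      fix i j assume ij: "i \<in> {..<r}" "j \<in> {..<r}" "h i = h j" "i \<noteq> j"
      then have "set (awalk_verts (u i) (p i)) \<inter> set (awalk_verts (u j) (p j)) = {}"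
        using disj by simp
      then show False using h[of i] h[of j] ij by auto
    qed
    then have "card {..<r} \<le> card D"
      using h assms(4) by (intro card_inj_on_le[of h]) auto
    then show False by (simp add: r_def)
  qed
  then obtain i where i: "i < r" and av: "set (awalk_verts (u i) (p i)) \<inter> D = {}" by blast
  define xs where "xs = awalk_verts (u i) (p i)"
  have w: "awalk (u i) (p i) (v i)" using path[rule_format, OF i] by (simp add: apath_def)
  have ne: "xs \<noteq> []" and hd: "hd xs = u i" and last: "last xs = v i"
    using w unfolding xs_def awalk_conv by simp_all
  have "successively (\<lambda>x y. (x, y) \<in> parcs (graph X)) xs"
    using successively_awalk_verts[OF w] by (simp add: xs_def)
  then have "(xs ! 0, xs ! (length xs - 1)) \<in> (arcs_avoiding (parcs (graph X)) D)\<^sup>*"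
    using av ne by (intro successively_arcs_avoiding) (auto simp: xs_def)
  then have "(u i, v i) \<in> (arcs_avoiding (parcs (graph X)) D)\<^sup>*"
    using hd last ne by (simp add: hd_conv_nth last_conv_nth)
  moreover have "u i \<in> set xs" using hd_in_set[OF ne] by (simp only: hd)
  then have "u i \<notin> D" using av by (auto simp: xs_def)
  moreover have "u i \<in> A" "v i \<in> B" using path[rule_format, OF i] A'(1) B'(1) by auto
  ultimately show ?thesis by blast
qed

section \<open>Arcs and reachability in the full graph\<close>

lemma M_graph_arcs:
  "(x, y) \<in> parcs (graph SC1) \<Longrightarrow> (First x, First y) \<in> parcs (graph (M_graph \<tau> G SC1 SC2 f g \<omega>))"
  "(a, b) \<in> parcs (G_graph \<tau> G \<omega>) \<Longrightarrow> (Mid a, Mid b) \<in> parcs (graph (M_graph \<tau> G SC1 SC2 f g \<omega>))"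
  "(s, t) \<in> parcs (graph SC2) \<Longrightarrow> (Last s, Last t) \<in> parcs (graph (M_graph \<tau> G SC1 SC2 f g \<omega>))"
  "x \<in> outputs SC1 \<Longrightarrow> (First x, Mid (V1 (f x))) \<in> parcs (graph (M_graph \<tau> G SC1 SC2 f g \<omega>))"
  "v \<in> pverts G \<Longrightarrow> (Mid (V3 v), Last (g v)) \<in> parcs (graph (M_graph \<tau> G SC1 SC2 f g \<omega>))"
  by (auto simp: M_graph_def)

text \<open>No arc enters the first superconcentrator from outside and none leaves the last one.
  Hence a hub in the middle reaches no input and is reached from no output.\<close>

lemma M_graph_arcs_monotone:
  assumes "(x, y) \<in> parcs (graph (M_graph \<tau> G SC1 SC2 f g \<omega>))"
  shows "y \<in> range First \<Longrightarrow> x \<in> range First" "x \<in> range Last \<Longrightarrow> y \<in> range Last"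
  using assms by (auto simp: M_graph_def)

text \<open>Every vertex on a walk to \<open>h\<close> itself reaches \<open>h\<close>, and every
  vertex on a walk from \<open>h\<close> is reached from it. Such walks therefore stay inside
  \<open>U\<close> and survive in the subgraph induced by \<open>U\<close>.\<close>

lemma rtrancl_on_through_hub:
  fixes E :: "('a \<times> 'a) set"
  assumes E: "E \<subseteq> A" and U: "U = {v \<in> S. (v, h) \<in> E\<^sup>* \<or> (h, v) \<in> E\<^sup>*}" and S: "Field E \<subseteq> S"
  shows "(s, h) \<in> E\<^sup>* \<Longrightarrow> s \<in> S \<Longrightarrow> h \<in> S \<Longrightarrow> (s, h) \<in> rtrancl_on U (A \<inter> U \<times> U)"
    and "(h, t) \<in> E\<^sup>* \<Longrightarrow> h \<in> S \<Longrightarrow> (h, t) \<in> rtrancl_on U (A \<inter> U \<times> U)"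
proof -
  assume "(s, h) \<in> E\<^sup>*" "s \<in> S" and h: "h \<in> S"
  then show "(s, h) \<in> rtrancl_on U (A \<inter> U \<times> U)"
  proof (induction rule: converse_rtrancl_induct)
    case base
    then show ?case using h by (auto simp: U)
  next
    case (step x y)
    have "x \<in> U" "y \<in> U" "(x, y) \<in> A"
      using step.hyps E S by (auto simp: U Field_def intro: converse_rtrancl_into_rtrancl)
    moreover have "y \<in> S" using step.hyps S by (auto simp: Field_def)
    ultimately show ?case
      using step.IH h by (intro converse_rtrancl_on_into_rtrancl_on[of x y]) auto
  qed
next
  assume "(h, t) \<in> E\<^sup>*" and h: "h \<in> S"
  then show "(h, t) \<in> rtrancl_on U (A \<inter> U \<times> U)"
  proof (induction rule: rtrancl_induct)
    case base
    then show ?case using h by (auto simp: U)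
  next
    case (step x y)
    have xy: "x \<in> U" "y \<in> U" "(x, y) \<in> A"
      using step.hyps E S by (auto simp: U Field_def intro: rtrancl_into_rtrancl)
    show ?case
      by (rule rtrancl_on_into_rtrancl_on[OF step.IH[OF h]]) (use xy in auto)
  qed
qed

text \<open>The deterministic core: outside both failure events a hub exists, and more than
  \<open>k\<close> vertices on each side connect to it because \<open>2 * k < m * L\<close>. The
  superconcentrators extend this to all but \<open>k\<close> inputs and outputs, and the witnessing
  subgraph is induced by the surviving vertices that reach the hub or are reached from it.\<close>

lemma st_robust_M_graph:
  fixes G :: "'a pair_pre_digraph" and SC1 :: "'b io_graph" and SC2 :: "'c io_graph"
    and \<omega> :: "'a gnode \<times> nat \<Rightarrow> 'a" and \<tau> :: nat and f :: "'b \<Rightarrow> 'a" and g :: "'a \<Rightarrow> 'c"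
  defines "M \<equiv> M_graph \<tau> G SC1 SC2 f g \<omega>"
  assumes "dag (graph M)" "superconcentrator n SC1" "superconcentrator n SC2"
    and f: "bij_betw f (outputs SC1) (pverts G)" and g: "bij_betw g (pverts G) (inputs SC2)"
    and G: "dag G" "depth_robust e d G"
    and \<omega>: "\<omega> \<notin> poorly_linked \<tau> V2 G L m" "\<omega> \<notin> poorly_linked \<tau> V3 G L m"
    and L: "real (k + 2 * L * m) \<le> e" "real (2 * L) \<le> d + 1" "L \<ge> 1"
    and k: "2 * k < m * L"
  shows "st_robust k (n - k) M"
  unfolding st_robust_def
proof (intro allI impI)
  fix D assume D: "D \<subseteq> pverts (graph M) \<and> card D \<le> k"
  interpret M: pair_fin_digraph "graph M" using assms(2) by (simp add: dag_def)
  have finD: "finite D" using D M.pair_finite_verts by (auto intro: finite_subset)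
  define E where "E = arcs_avoiding (parcs (graph M)) D"
  have le1: "card (First -` D) \<le> k" and le2: "card (Mid -` D) \<le> k" and le3: "card (Last -` D) \<le> k"
    using vimage_card_le[of First D] vimage_card_le[of Mid D] vimage_card_le[of Last D] finD D
    by (simp_all add: inj_def)
  have fin: "finite (First -` D)" "finite (Mid -` D)" "finite (Last -` D)"
    using finD by (auto intro!: finite_vimageI simp: inj_def)
  have "real (card (Mid -` D) + 2 * L * m) \<le> real (k + 2 * L * m)"
    using le2 by (simp only: of_nat_le_iff add_le_cancel_right)
  also have "\<dots> \<le> e" by fact
  finally have "real (card (Mid -` D) + 2 * L * m) \<le> e" .
  from exists_hub[OF G \<omega> fin(2) this L(2,3)]
  obtain z where z: "z \<in> pverts G" "Mid (V2 z) \<notin> D"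
    and A: "m * L \<le> 2 * card {x \<in> pverts G. V1 x \<notin> Mid -` D \<and>
        (V1 x, V2 z) \<in> (arcs_avoiding (parcs (G_graph \<tau> G \<omega>)) (Mid -` D))\<^sup>*}" (is "_ \<le> 2 * card ?A")
    and B: "m * L \<le> 2 * card {x \<in> pverts G. V3 x \<notin> Mid -` D \<and>
        (V2 z, V3 x) \<in> (arcs_avoiding (parcs (G_graph \<tau> G \<omega>)) (Mid -` D))\<^sup>*}" (is "_ \<le> 2 * card ?B")
    by auto
  define A1 where "A1 = ?A"
  define B1 where "B1 = ?B"
  note A = A[folded A1_def] and B = B[folded B1_def]
  have A1_verts: "A1 \<subseteq> pverts G" and B1_verts: "B1 \<subseteq> pverts G" by (auto simp: A1_def B1_def)
  have A1_D: "Mid (V1 x) \<notin> D" if "x \<in> A1" for x using that by (simp add: A1_def)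
  have B1_D: "Mid (V3 x) \<notin> D" if "x \<in> B1" for x using that by (simp add: B1_def)
  define h where "h = (Mid (V2 z) :: ('a, 'b, 'c) mnode)"
  have h: "h \<in> pverts (graph M) - D" using z by (auto simp: h_def M_def M_graph_def G_graph_def)
  have A_E: "(Mid (V1 x), h) \<in> E\<^sup>*" if "x \<in> A1" for x
    unfolding h_def E_def M_def
    by (rule arcs_avoiding_rtrancl_map[where f = Mid, OF _ M_graph_arcs(2)]) (use that in \<open>auto simp: A1_def\<close>)
  have B_E: "(h, Mid (V3 x)) \<in> E\<^sup>*" if "x \<in> B1" for x
    unfolding h_def E_def M_def
    by (rule arcs_avoiding_rtrancl_map[where f = Mid, OF _ M_graph_arcs(2)]) (use that in \<open>auto simp: B1_def\<close>)
  have io1: "io_dag n SC1" and io2: "io_dag n SC2"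
    using assms(3,4) by (auto simp: superconcentrator_def)
  have fin_in: "finite (inputs SC1)" and fin_out: "finite (outputs SC2)"
    using io1 io2 by (auto simp: io_dag_def dag_def pair_fin_digraph_def pair_fin_digraph_axioms_def
        intro: finite_subset)

  define I where "I = {x \<in> inputs SC1. First x \<notin> D \<and> (First x, h) \<in> E\<^sup>*}"
  \<comment> \<open>Otherwise more than \<open>k\<close> inputs outside \<open>I\<close> face more
    than \<open>k\<close> outputs attached to \<open>A1\<close>. A surviving path between the two
    sets continues to the hub and puts its start into \<open>I\<close>.\<close>
  have "card (inputs SC1 - I) \<le> k"
  proof (rule ccontr)
    assume "\<not> ?thesis"
    then have "card (First -` D) < card (inputs SC1 - I)" using le1 by linarith
    moreover have "card (First -` D) < card {x \<in> outputs SC1. f x \<in> A1}"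
    proof -
      have "f ` {x \<in> outputs SC1. f x \<in> A1} = A1"
        using f A1_verts by (auto simp: bij_betw_def)
      moreover have "inj_on f {x \<in> outputs SC1. f x \<in> A1}"
        using f by (auto simp: bij_betw_def inj_on_def)
      ultimately have "card {x \<in> outputs SC1. f x \<in> A1} = card A1"
        using card_image[of f "{x \<in> outputs SC1. f x \<in> A1}"] by (simp only:)
      then show ?thesis using A k le1 by linarith
    qed
    ultimately have "\<exists>a\<in>inputs SC1 - I. \<exists>b\<in>{x \<in> outputs SC1. f x \<in> A1}. a \<notin> First -` D \<and>
        (a, b) \<in> (arcs_avoiding (parcs (graph SC1)) (First -` D))\<^sup>*"
      by (intro superconcentrator_path_avoiding[OF assms(3) _ _ fin(1)]) auto
    then obtain a b where a: "a \<in> inputs SC1 - I" "a \<notin> First -` D"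
      and b: "b \<in> outputs SC1" "f b \<in> A1"
      and ab: "(a, b) \<in> (arcs_avoiding (parcs (graph SC1)) (First -` D))\<^sup>*"
      by blast
    have "(First a, First b) \<in> E\<^sup>*"
      unfolding E_def M_def by (rule arcs_avoiding_rtrancl_map[OF ab M_graph_arcs(1)])
    also have "(First b, Mid (V1 (f b))) \<in> E"
      using arcs_avoiding_rtrancl_notin[OF ab a(2)] A1_D[OF b(2)] M_graph_arcs(4)[OF b(1)]
      by (auto simp: E_def arcs_avoiding_def M_def)
    also (rtrancl_into_rtrancl) have "(Mid (V1 (f b)), h) \<in> E\<^sup>*" by (rule A_E[OF b(2)])
    finally show False using a by (auto simp: I_def)
  qed
  then have cI: "n - k \<le> card I"
    using io1 fin_in card_Diff_subset[of I "inputs SC1"] by (auto simp: I_def io_dag_def)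

  define J where "J = {y \<in> outputs SC2. Last y \<notin> D \<and> (h, Last y) \<in> E\<^sup>*}"
  \<comment> \<open>The mirror image: the walk runs from the hub through \<open>B1\<close> and the
    second superconcentrator to an output outside \<open>J\<close>.\<close>
  have "card (outputs SC2 - J) \<le> k"
  proof (rule ccontr)
    assume "\<not> ?thesis"
    then have "card (Last -` D) < card (outputs SC2 - J)" using le3 by linarith
    moreover have "card (Last -` D) < card (g ` B1)"
    proof -
      have "inj_on g B1" using g B1_verts by (auto simp: bij_betw_def intro: inj_on_subset)
      then have "card (g ` B1) = card B1" by (rule card_image)
      then show ?thesis using B k le3 by linarith
    qed
    moreover have "g ` B1 \<subseteq> inputs SC2" using g B1_verts by (auto simp: bij_betw_def)
    ultimately have "\<exists>a\<in>g ` B1. \<exists>b\<in>outputs SC2 - J. a \<notin> Last -` D \<and>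
        (a, b) \<in> (arcs_avoiding (parcs (graph SC2)) (Last -` D))\<^sup>*"
      by (intro superconcentrator_path_avoiding[OF assms(4) _ _ fin(3)]) auto
    then obtain v b where v: "v \<in> B1" "g v \<notin> Last -` D" and b: "b \<in> outputs SC2 - J"
      and ab: "(g v, b) \<in> (arcs_avoiding (parcs (graph SC2)) (Last -` D))\<^sup>*"
      by blast
    have "(h, Mid (V3 v)) \<in> E\<^sup>*" by (rule B_E[OF v(1)])
    also have "(Mid (V3 v), Last (g v)) \<in> E"
      using v B1_D[OF v(1)] M_graph_arcs(5)[of v G] subsetD[OF B1_verts v(1)] by (auto simp: E_def arcs_avoiding_def M_def)
    also (rtrancl_into_rtrancl) have "(Last (g v), Last b) \<in> E\<^sup>*"
      unfolding E_def M_def by (rule arcs_avoiding_rtrancl_map[OF ab M_graph_arcs(3)])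
    finally show False
      using b arcs_avoiding_rtrancl_notin[OF ab v(2)] by (auto simp: J_def)
  qed
  then have cJ: "n - k \<le> card J"
    using io2 fin_out card_Diff_subset[of J "outputs SC2"] by (auto simp: J_def io_dag_def)

  define S where "S = pverts (graph M) - D"
  define U where "U = {v \<in> S. (v, h) \<in> E\<^sup>* \<or> (h, v) \<in> E\<^sup>*}"
  define K where "K = induce_subgraph (with_proj (graph M)) U"
  have vK: "verts K = U" by (simp add: K_def)
  have "arcs_ends K = parcs (graph M) \<inter> U \<times> U"
    by (auto simp: K_def arcs_ends_conv image_iff)
  note reach = rtrancl_on_through_hub[of E "parcs (graph M)" U S h, OF _ U_def, folded this vK, folded reachable_def]
  have ES: "E \<subseteq> parcs (graph M)" "Field E \<subseteq> S"
    using M.in_arcsD1 M.in_arcsD2 by (auto simp: E_def arcs_avoiding_def S_def Field_def)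
  have hS: "h \<in> S" using h by (simp add: S_def)
  \<comment> \<open>\<open>U\<close> holds vertices from both sides of the hub. This excludes inputs
    lying in \<open>U\<close> as descendants of \<open>h\<close>, so the inputs in the subgraph are
    exactly those of \<open>I\<close>; \<open>Last_E\<close> does the same for outputs.\<close>
  have First_E: "(h, First x) \<notin> E\<^sup>*" for x
  proof -
    have "y \<notin> range First" if "(h, y) \<in> E\<^sup>*" for y
      using that
    proof (induction rule: rtrancl_induct)
      case (step x y)
      then show ?case using M_graph_arcs_monotone(1) ES(1) unfolding M_def by blast
    qed (auto simp: h_def)
    then show ?thesis by blast
  qed
  have Last_E: "(Last x, h) \<notin> E\<^sup>*" for x
  proof -
    have "y \<notin> range Last" if "(y, h) \<in> E\<^sup>*" for y
      using that
    proof (induction rule: converse_rtrancl_induct)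
      case (step x y)
      then show ?case using M_graph_arcs_monotone(2) ES(1) unfolding M_def by blast
    qed (auto simp: h_def)
    then show ?thesis by blast
  qed
  have ins: "inputs M \<inter> verts K = First ` I"
    using First_E io1 by (auto simp: vK U_def S_def I_def M_def M_graph_def io_dag_def)
  have outs: "outputs M \<inter> verts K = Last ` J"
    using Last_E io2 by (auto simp: vK U_def S_def J_def M_def M_graph_def io_dag_def)
  have "subgraph K (del_verts (graph M) D)"
    unfolding subgraph_def
  proof (intro conjI)
    show "wf_digraph (del_verts (graph M) D)" "wf_digraph K"
      using M.wf_digraph_axioms by (auto simp: K_def wf_digraph.wellformed_induce_subgraph)
  qed (auto simp: K_def U_def S_def compatible_def)
  moreover have "n - k \<le> card (inputs M \<inter> verts K)" "n - k \<le> card (outputs M \<inter> verts K)"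
    using cI cJ by (simp_all add: ins outs card_image inj_on_def)
  moreover have "s \<rightarrow>\<^sup>*\<^bsub>K\<^esub> t" if "s \<in> inputs M \<inter> verts K" "t \<in> outputs M \<inter> verts K" for s t
  proof -
    have s: "(s, h) \<in> E\<^sup>*" "s \<in> S" using that(1) unfolding ins
      using that(1) by (auto simp: I_def vK U_def)
    have t: "(h, t) \<in> E\<^sup>*" using that(2) unfolding outs by (auto simp: J_def)
    show ?thesis
      using reach(1)[OF ES s hS] reach(2)[OF ES t hS]
      unfolding reachable_def by (rule rtrancl_on_trans)
  qed
  ultimately show "\<exists>H. subgraph H (del_verts (graph M) D) \<and>
     n - k \<le> card (inputs M \<inter> verts H) \<and> n - k \<le> card (outputs M \<inter> verts H) \<and>
     (\<forall>s\<in>inputs M \<inter> verts H. \<forall>t\<in>outputs M \<inter> verts H. s \<rightarrow>\<^sup>*\<^bsub>H\<^esub> t)"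
    by blast
qed

section \<open>Acyclicity, indegree and parameters\<close>

text \<open>The rank is the number of proper ancestors: along an arc the ancestors are inherited,
  and by acyclicity the tail is a new one.\<close>

lemma dag_exists_topological_rank:
  assumes "dag G"
  shows "\<exists>h :: 'a \<Rightarrow> nat. \<forall>x y. (x, y) \<in> parcs G \<longrightarrow> h x < h y"
proof -
  interpret pair_fin_digraph G using assms by (simp add: dag_def)
  let ?h = "\<lambda>x. card {z. (z, x) \<in> (parcs G)\<^sup>+}"
  have "?h x < ?h y" if "(x, y) \<in> parcs G" for x y
  proof (rule psubset_card_mono)
    have "{z. (z, y) \<in> (parcs G)\<^sup>+} \<subseteq> fst ` (parcs G)\<^sup>+" by (auto intro: rev_image_eqI)
    then show "finite {z. (z, y) \<in> (parcs G)\<^sup>+}"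
      by (rule finite_subset) (simp add: pair_finite_arcs)
    have "(x, x) \<notin> (parcs G)\<^sup>+" using assms by (simp add: dag_def acyclic_def)
    moreover have "(x, y) \<in> (parcs G)\<^sup>+" using that by (rule r_into_trancl)
    moreover have "(z, y) \<in> (parcs G)\<^sup>+" if "(z, x) \<in> (parcs G)\<^sup>+" for z
      using that \<open>(x, y) \<in> parcs G\<close> by (rule trancl_into_trancl)
    ultimately show "{z. (z, x) \<in> (parcs G)\<^sup>+} \<subset> {z. (z, y) \<in> (parcs G)\<^sup>+}"
      by blast
  qed
  then show ?thesis by (intro exI[of _ ?h] allI impI)
qed

lemma io_dag_M_graph:
  assumes G: "dag G" and io1: "io_dag n SC1" and io2: "io_dag n SC2"
    and f: "f ` outputs SC1 \<subseteq> pverts G" and g: "g ` pverts G \<subseteq> inputs SC2"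
    and \<omega>: "\<And>v i. v \<in> pverts G \<Longrightarrow> i < \<tau> \<Longrightarrow> \<omega> (V2 v, i) \<in> pverts G \<and> \<omega> (V3 v, i) \<in> pverts G"
  shows "io_dag n (M_graph \<tau> G SC1 SC2 f g \<omega>)"
proof -
  let ?M = "M_graph \<tau> G SC1 SC2 f g \<omega>"
  have dags: "dag (graph SC1)" "dag (graph SC2)" using io1 io2 by (simp_all add: io_dag_def)
  interpret G: pair_fin_digraph G using G by (simp add: dag_def)
  interpret S1: pair_fin_digraph "graph SC1" using dags by (simp add: dag_def)
  interpret S2: pair_fin_digraph "graph SC2" using dags by (simp add: dag_def)
  note fin = G.pair_finite_verts G.pair_finite_arcs S1.pair_finite_verts S1.pair_finite_arcs
    S2.pair_finite_verts S2.pair_finite_arcs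
  have outs: "outputs SC1 \<subseteq> pverts (graph SC1)" and ins: "inputs SC2 \<subseteq> pverts (graph SC2)"
    using io1 io2 by (auto simp: io_dag_def)
  have f': "f x \<in> pverts G" if "x \<in> outputs SC1" for x using f that by auto
  have g': "g v \<in> pverts (graph SC2)" if "v \<in> pverts G" for v using g ins that by auto
  have wf: "x \<in> pverts (graph ?M) \<and> y \<in> pverts (graph ?M)" if "(x, y) \<in> parcs (graph ?M)" for x y
    using that f' g' \<omega> outs
    by (auto simp: M_graph_def G_graph_def dest: G.wellformed' S1.wellformed' S2.wellformed')
  have finv: "finite (pverts (graph ?M))"
    using fin by (simp add: M_graph_def G_graph_def)
  have "finite (parcs (graph ?M))"
    by (rule finite_subset[of _ "pverts (graph ?M) \<times> pverts (graph ?M)"]) (use wf finv in auto)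
  then have "pair_fin_digraph (graph ?M)"
    using wf finv by unfold_locales auto
  moreover have "acyclic (parcs (graph ?M))"
  proof -
    obtain h h1 h2 :: "_ \<Rightarrow> nat" where h: "\<And>x y. (x, y) \<in> parcs G \<Longrightarrow> h x < h y"
      "\<And>x y. (x, y) \<in> parcs (graph SC1) \<Longrightarrow> h1 x < h1 y"
      "\<And>x y. (x, y) \<in> parcs (graph SC2) \<Longrightarrow> h2 x < h2 y"
      using dag_exists_topological_rank[OF G] dag_exists_topological_rank[OF dags(1)]
        dag_exists_topological_rank[OF dags(2)] by blast
    \<comment> \<open>Lexicographic rank: the layer first, then a topological rank within it. Arcs
      between layers raise the first component and arcs inside a layer the second.\<close>
    define w :: "_ \<Rightarrow> nat \<times> nat" where "w = (\<lambda>v. case v of First x \<Rightarrow> (0, h1 x)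
      | Mid a \<Rightarrow> (case a of V1 x \<Rightarrow> (1, h x) | V2 x \<Rightarrow> (2, h x) | V3 x \<Rightarrow> (3, h x))
      | Last x \<Rightarrow> (4, h2 x))"
    have "parcs (graph ?M) \<subseteq> inv_image (less_than <*lex*> less_than) w"
      using h by (auto simp: M_graph_def G_graph_def w_def)
    moreover have "acyclic (inv_image (less_than <*lex*> less_than) w)"
      by (intro wf_acyclic wf_inv_image wf_lex_prod wf_less_than)
    ultimately show ?thesis by (metis acyclic_subset)
  qed
  ultimately show ?thesis
    using io1 io2 unfolding io_dag_def dag_def
    by (auto simp: M_graph_def card_image inj_on_def)
qed

section \<open>Bounded indegree\<close>

lemma card_le_two_images:
  assumes "N \<subseteq> F ` A \<union> F' ` B" "finite A" "finite B"
  shows "card N \<le> card A + card B"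
proof -
  have "card N \<le> card (F ` A \<union> F' ` B)" using assms by (intro card_mono) auto
  also have "\<dots> \<le> card (F ` A) + card (F' ` B)" by (rule card_Un_le)
  also have "\<dots> \<le> card A + card B" using assms by (intro add_mono card_image_le)
  finally show ?thesis .
qed

lemma indegree_leI:
  assumes "\<And>v. v \<in> pverts G \<Longrightarrow> card {u. (u, v) \<in> parcs G} \<le> k"
  shows "indegree_le k G"
proof -
  have "in_arcs (with_proj G) v = (\<lambda>u. (u, v)) ` {u. (u, v) \<in> parcs G}" for v
    by (auto simp: in_arcs_def)
  then show ?thesis
    using assms by (simp add: indegree_le_def in_degree_def card_image inj_on_def)
qed

text \<open>Besides the arcs of its own component, a vertex receives at most one attaching arc, by
  injectivity of \<open>f\<close> and \<open>g\<close>, or at most \<tau> sampled arcs. Samples may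
  coincide, so in-neighbourhoods are bounded by images of index sets.\<close>

lemma indegree_le_M_graph:
  assumes G: "dag G" and io1: "io_dag n SC1" and io2: "io_dag n SC2"
    and f: "inj_on f (outputs SC1)" and g: "inj_on g (pverts G)"
    and k: "indegree_le k G" "indegree_le k1 (graph SC1)" "indegree_le k2 (graph SC2)"
  shows "indegree_le (k + k1 + k2 + \<tau> + 1) (graph (M_graph \<tau> G SC1 SC2 f g \<omega>))"
proof (rule indegree_leI)
  let ?M = "graph (M_graph \<tau> G SC1 SC2 f g \<omega>)"
  interpret G: pair_fin_digraph G using G by (simp add: dag_def)
  interpret S1: pair_fin_digraph "graph SC1" using io1 by (simp add: io_dag_def dag_def)
  interpret S2: pair_fin_digraph "graph SC2" using io2 by (simp add: io_dag_def dag_def)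
  have fG: "finite {u. (u, x) \<in> parcs G}" for x
    by (rule finite_subset[OF _ G.pair_finite_verts]) (auto dest: G.in_arcsD1)
  have f1: "finite {u. (u, x) \<in> parcs (graph SC1)}" for x
    by (rule finite_subset[OF _ S1.pair_finite_verts]) (auto dest: S1.in_arcsD1)
  have f2: "finite {u. (u, x) \<in> parcs (graph SC2)}" for x
    by (rule finite_subset[OF _ S2.pair_finite_verts]) (auto dest: S2.in_arcsD1)
  have finO: "finite (outputs SC1)"
    using io1 S1.pair_finite_verts by (auto simp: io_dag_def intro: finite_subset)
  have cf: "card {y \<in> outputs SC1. f y = x} \<le> 1" for x
    using f finO by (auto simp: card_le_Suc0_iff_eq inj_on_def)
  have cg: "card {v \<in> pverts G. g v = x} \<le> 1" for x
    using g G.pair_finite_verts by (auto simp: card_le_Suc0_iff_eq inj_on_def)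
  fix v assume v: "v \<in> pverts ?M"
  let ?N = "{u. (u, v) \<in> parcs ?M}"
  consider (First) x where "v = First x" "x \<in> pverts (graph SC1)"
    | (V1) x where "v = Mid (V1 x)" "x \<in> pverts G"
    | (V2) x where "v = Mid (V2 x)" "x \<in> pverts G"
    | (V3) x where "v = Mid (V3 x)" "x \<in> pverts G"
    | (Last) x where "v = Last x" "x \<in> pverts (graph SC2)"
    using v by (auto simp: M_graph_def G_graph_def)
  then show "card ?N \<le> k + k1 + k2 + \<tau> + 1"
  proof cases
    case First
    have "?N \<subseteq> First ` {u. (u, x) \<in> parcs (graph SC1)} \<union> First ` {}"
      using First by (auto simp: M_graph_def G_graph_def)
    from card_le_two_images[OF this f1 finite.emptyI] card_in_neighbours_le[OF k(2) First(2)]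
    show ?thesis by simp
  next
    case V1
    have "?N \<subseteq> (\<lambda>u. Mid (V1 u)) ` {u. (u, x) \<in> parcs G} \<union> First ` {y \<in> outputs SC1. f y = x}"
      using V1 by (auto simp: M_graph_def G_graph_def)
    from card_le_two_images[OF this fG] finO card_in_neighbours_le[OF k(1) V1(2)] cf[of x]
    show ?thesis by simp
  next
    case V2
    have "?N \<subseteq> (\<lambda>u. Mid (V2 u)) ` {u. (u, x) \<in> parcs G} \<union> (\<lambda>i. Mid (V1 (\<omega> (V2 x, i)))) ` {..<\<tau>}"
      using V2 by (auto simp: M_graph_def G_graph_def)
    from card_le_two_images[OF this fG] card_in_neighbours_le[OF k(1) V2(2)]
    show ?thesis by simp
  next
    case V3
    have "?N \<subseteq> (\<lambda>u. Mid (V3 u)) ` {u. (u, x) \<in> parcs G} \<union> (\<lambda>i. Mid (V2 (\<omega> (V3 x, i)))) ` {..<\<tau>}"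
      using V3 by (auto simp: M_graph_def G_graph_def)
    from card_le_two_images[OF this fG] card_in_neighbours_le[OF k(1) V3(2)]
    show ?thesis by simp
  next
    case Last
    have "?N \<subseteq> Last ` {u. (u, x) \<in> parcs (graph SC2)} \<union> (\<lambda>v. Mid (V3 v)) ` {v \<in> pverts G. g v = x}"
      using Last by (auto simp: M_graph_def G_graph_def)
    from card_le_two_images[OF this f2] G.pair_finite_verts card_in_neighbours_le[OF k(3) Last(2)] cg[of x]
    show ?thesis by simp
  qed
qed

section \<open>Support of the samples and asymptotic parameters\<close>

lemma samples_in_verts:
  assumes "finite (pverts G)" "\<omega> \<in> set_pmf (samples \<tau> G)" "v \<in> pverts G" "i < \<tau>"
  shows "\<omega> (V2 v, i) \<in> pverts G \<and> \<omega> (V3 v, i) \<in> pverts G"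
proof -
  have ne: "pverts G \<noteq> {}" using assms(3) by auto
  have "\<omega> x \<in> pverts G" if "x \<in> (V2 ` pverts G \<union> V3 ` pverts G) \<times> {..<\<tau>}" for x
  proof -
    have "finite ((V2 ` pverts G \<union> V3 ` pverts G) \<times> {..<\<tau>})" using assms(1) by simp
    from set_Pi_pmf[OF this, of undefined "\<lambda>_. pmf_of_set (pverts G)"] have "\<omega> x \<in> set_pmf (pmf_of_set (pverts G))"
      using that assms(2) unfolding samples_def by (auto simp: PiE_dflt_def)
    then show ?thesis using ne assms(1) by simp
  qed
  then show ?thesis using assms(3,4) by simp
qed

text \<open>The depth caps \<open>L\<close> at order n^(2/3), while \<open>m\<close> \<le>
  \<open>L\<close> with \<open>m * L\<close> of linear order forces \<open>L\<close> to be at least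
  of order sqrt n. Taking \<open>L\<close> near sqrt n meets both and still gives \<open>n\<close>
  \<le> \<open>2 ^ L\<close> eventually.\<close>

lemma eventually_path_parameters:
  fixes c :: real
  assumes "0 < c" "c \<le> 1"
  shows "\<forall>\<^sub>F n in sequentially. \<exists>L m. 1 \<le> L \<and> n \<le> 2 ^ L \<and> m * L \<le> n \<and> m \<le> L \<and>
    c / 8 * real n \<le> real (m * L) \<and> real (2 * L * m) \<le> c / 2 * real n \<and>
    real (2 * L) \<le> real n powr (2 / 3) + 1"
proof -
  have e1: "\<forall>\<^sub>F n in sequentially. 2 * (sqrt (real n) + 1) \<le> real n powr (2 / 3) + 1"
    by real_asymp
  have "(\<lambda>n. (sqrt (real n) + 1) / real n) \<longlonglongrightarrow> 0" by real_asymp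
  then have e2: "\<forall>\<^sub>F n in sequentially. (sqrt (real n) + 1) / real n < c / 8"
    using assms by (intro order_tendstoD) auto
  have e3: "\<forall>\<^sub>F n in sequentially. real n \<le> 2 powr sqrt (real n)" by real_asymp
  show ?thesis
    using e1 e2 e3 eventually_gt_at_top[of 0]
  proof eventually_elim
    case (elim n)
    define L where "L = nat \<lceil>sqrt (real n)\<rceil>"
    \<comment> \<open>This makes \<open>m * L\<close> at most \<open>c / 4 * n\<close>; rounding
      down loses less than \<open>L\<close>, which is eventually below
      \<open>c / 8 * n\<close>.\<close>
    define m where "m = nat \<lfloor>c * real n / (4 * real L)\<rfloor>"
    have Ls: "sqrt (real n) \<le> real L" unfolding L_def by (simp add: real_nat_ceiling_ge)
    have "0 \<le> \<lceil>sqrt (real n)\<rceil>" using ceiling_mono[of 0 "sqrt (real n)"] by simp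
    then have Lu: "real L \<le> sqrt (real n) + 1"
      unfolding L_def using of_int_ceiling_le_add_one[of "sqrt (real n)"] by simp
    have n: "real n > 0" "sqrt (real n) > 0" using elim by auto
    then have L0: "real L > 0" using Ls by linarith
    have mu: "real m \<le> c * real n / (4 * real L)" using assms by (simp add: m_def)
    have "0 \<le> \<lfloor>c * real n / (4 * real L)\<rfloor>" using assms by simp
    then have ml: "c * real n / (4 * real L) - 1 < real m"
      unfolding m_def using floor_correct[of "c * real n / (4 * real L)"] by simp
    have mLu: "real m * real L \<le> c / 4 * real n"
      using mult_right_mono[OF mu, of "real L"] L0 by simp
    have "c * real n / 4 - real L < real m * real L"
      using mult_strict_right_mono[OF ml L0] L0 by (simp add: algebra_simps)
    moreover have "sqrt (real n) + 1 < c / 8 * real n" using elim(2) n by (simp add: divide_less_eq)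
    ultimately have mLl: "c / 8 * real n \<le> real m * real L" using Lu by linarith
    have "real n \<le> 2 powr real L" using elim(3) Ls by (meson order_trans powr_mono one_le_numeral)
    then have "real n \<le> real (2 ^ L)" by (simp add: powr_realpow)
    then have n2: "n \<le> 2 ^ L" by (simp only: of_nat_le_iff)
    have cn: "c / 4 * real n \<le> real n" using assms n by (simp add: field_simps)
    then have "real (m * L) \<le> real n" using mLu by simp
    then have mLn: "m * L \<le> n" by (simp only: of_nat_le_iff)
    have "real n = sqrt (real n) * sqrt (real n)" by simp
    also have "\<dots> \<le> real L * real L" using Ls n by (intro mult_mono) auto
    finally have "real m * real L \<le> real L * real L" using mLu cn by linarith
    then have "m \<le> L" using L0 by simp
    moreover have "1 \<le> L" using L0 by simp
    moreover have "real (2 * L * m) \<le> c / 2 * real n" using mLu by (simp add: mult_ac)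
    moreover have "real (2 * L) \<le> real n powr (2 / 3) + 1" using elim(1) Lu by simp
    ultimately show ?case using n2 mLn mLl by (metis of_nat_mult)
  qed
qed

section \<open>Choice of constants and passage to the limit\<close>

theorem theorem4:
  fixes H :: "nat \<Rightarrow> 'a pair_pre_digraph" and c :: real
  assumes "\<forall>n. dag (H n) \<and> card (pverts (H n)) = n"
    and "\<exists>k. \<forall>n. indegree_le k (H n)"
    and "c > 0"
    and "\<forall>\<^sub>F n in sequentially. depth_robust (c * real n) (real n powr (2 / 3)) (H n)"
  shows "\<exists>\<tau>. \<forall>(SC1 :: nat \<Rightarrow> 'b io_graph) (SC2 :: nat \<Rightarrow> 'c io_graph) f g.
    linear_superconcentrators SC1 \<and> linear_superconcentrators SC2 \<and>
    (\<forall>n. bij_betw (f n) (outputs (SC1 n)) (pverts (H n)) \<and>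
         bij_betw (g n) (pverts (H n)) (inputs (SC2 n))) \<longrightarrow>
    (let M = (\<lambda>n. M_graph \<tau> (H n) (SC1 n) (SC2 n) (f n) (g n)) in
      (\<exists>c'>0.
        (\<lambda>n. measure_pmf.prob (samples \<tau> (H n))
           {\<omega>. \<forall>S \<subseteq> pverts (graph (M n \<omega>)). real (card S) \<le> c' * real n / 2 \<longrightarrow>
                 st_robust (card S) (n - card S) (M n \<omega>)}) \<longlonglongrightarrow> 1) \<and>
      (\<exists>k. \<forall>n. \<forall>\<omega> \<in> set_pmf (samples \<tau> (H n)).
         io_dag n (M n \<omega>) \<and> indegree_le k (graph (M n \<omega>))))"
proof -
  obtain k0 where k0: "\<And>n. indegree_le k0 (H n)" using assms(2) by blast
  define k where "k = k0 + 1"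
  have k: "k \<ge> 1" "\<And>n. indegree_le k (H n)"
    using k0 by (auto simp: k_def indegree_le_def intro: le_SucI)
  have H: "dag (H n)" "card (pverts (H n)) = n" for n using assms(1) by auto
  have finH: "finite (pverts (H n))" for n
    using H(1)[of n] by (simp add: dag_def pair_fin_digraph.pair_finite_verts)
  \<comment> \<open>Capping the constant at 1 ensures that the paths of a family fit into
    \<open>n\<close> vertices.\<close>
  define c0 where "c0 = min c 1"
  have c0: "0 < c0" "c0 \<le> 1" "c0 \<le> c" using assms(3) by (auto simp: c0_def)
  \<comment> \<open>Chosen so that \<open>8 * \<eta>\<close> equals \<open>c0 / 8\<close>, the
    guaranteed fraction of \<open>m * L\<close>.\<close>
  define \<eta> where "\<eta> = c0 / 64"
  have \<eta>: "\<eta> > 0" using c0 by (simp add: \<eta>_def)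
  \<comment> \<open>Large enough for the exponential gain per vertex to beat the entropy
    \<open>8 * k ^ 4\<close> by a factor 2. It depends only on the constants of \<open>H\<close>, so
    it is fixed before the superconcentrators.\<close>
  obtain \<tau> :: nat where "ln (16 * real k ^ 4) / \<eta>\<^sup>2 \<le> real \<tau>" using real_arch_simple by blast
  then have "ln (16 * real k ^ 4) \<le> \<eta>\<^sup>2 * real \<tau>" using \<eta> by (simp add: divide_le_eq mult.commute)
  then have "exp (ln (16 * real k ^ 4)) \<le> exp (\<eta>\<^sup>2 * real \<tau>)" by (simp only: exp_le_cancel_iff)
  moreover have "exp (ln (16 * real k ^ 4)) = 16 * real k ^ 4" using k(1) by (intro exp_ln) simp
  ultimately have "16 * real k ^ 4 \<le> exp (\<eta>\<^sup>2 * real \<tau>)" by (simp only:)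
  then have \<tau>: "8 * real k ^ 4 * exp (- (\<eta>\<^sup>2 * real \<tau>)) \<le> 1 / 2"
    by (simp add: exp_minus field_simps)
  have small: "(8 * real k ^ 4) ^ n * exp (- (\<eta>\<^sup>2 * real \<tau> * real n)) \<le> (1 / 2) ^ n" for n
  proof -
    have "(8 * real k ^ 4) ^ n * exp (- (\<eta>\<^sup>2 * real \<tau> * real n)) =
        (8 * real k ^ 4 * exp (- (\<eta>\<^sup>2 * real \<tau>))) ^ n"
      by (simp add: power_mult_distrib exp_of_nat_mult[symmetric] mult_ac)
    also have "\<dots> \<le> (1 / 2) ^ n" using \<tau> by (intro power_mono) auto
    finally show ?thesis .
  qed
  show ?thesis
  proof (intro exI[of _ \<tau>] allI impI)
    fix SC1 :: "nat \<Rightarrow> 'b io_graph" and SC2 :: "nat \<Rightarrow> 'c io_graph" and f g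
    assume asm: "linear_superconcentrators SC1 \<and> linear_superconcentrators SC2 \<and>
      (\<forall>n. bij_betw (f n) (outputs (SC1 n)) (pverts (H n)) \<and>
           bij_betw (g n) (pverts (H n)) (inputs (SC2 n)))"
    have sc: "superconcentrator n (SC1 n)" "superconcentrator n (SC2 n)" for n
      using asm by (auto simp: linear_superconcentrators_def)
    then have io: "io_dag n (SC1 n)" "io_dag n (SC2 n)" for n
      by (auto simp: superconcentrator_def)
    obtain k1 k2 where k12: "\<And>n. indegree_le k1 (graph (SC1 n))" "\<And>n. indegree_le k2 (graph (SC2 n))"
      using asm unfolding linear_superconcentrators_def by blast
    have fg: "bij_betw (f n) (outputs (SC1 n)) (pverts (H n))"
      "bij_betw (g n) (pverts (H n)) (inputs (SC2 n))" for n using asm by auto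
    define M where "M = (\<lambda>n. M_graph \<tau> (H n) (SC1 n) (SC2 n) (f n) (g n))"
    have ioM: "io_dag n (M n \<omega>)" if "\<omega> \<in> set_pmf (samples \<tau> (H n))" for n \<omega>
      unfolding M_def
    proof (rule io_dag_M_graph[OF H(1) io])
      show "f n ` outputs (SC1 n) \<subseteq> pverts (H n)" "g n ` pverts (H n) \<subseteq> inputs (SC2 n)"
        using fg[of n] by (auto simp: bij_betw_def)
    qed (rule samples_in_verts[OF finH that])
    have degM: "indegree_le (k + k1 + k2 + \<tau> + 1) (graph (M n \<omega>))" for n \<omega>
      unfolding M_def
      by (rule indegree_le_M_graph[OF H(1) io _ _ k(2) k12]) (use fg[of n] in \<open>auto simp: bij_betw_def\<close>)
    \<comment> \<open>With \<open>c0 / 16\<close> as the constant, \<open>card S\<close> is at most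
      \<open>c0 * n / 32\<close>. Then \<open>2 * card S < m * L\<close>, and
      \<open>card S + 2 * L * m\<close> stays below \<open>c * n\<close>.\<close>
    define good where "good = (\<lambda>n. {\<omega>. \<forall>S \<subseteq> pverts (graph (M n \<omega>)).
      real (card S) \<le> c0 / 16 * real n / 2 \<longrightarrow> st_robust (card S) (n - card S) (M n \<omega>)})"
    have low: "\<forall>\<^sub>F n in sequentially. 1 - 2 * (1 / 2) ^ n \<le> measure_pmf.prob (samples \<tau> (H n)) (good n)"
      using eventually_path_parameters[OF c0(1,2)] assms(4) eventually_gt_at_top[of 0]
    proof eventually_elim
      case (elim n)
      from elim(1) obtain L m where L: "1 \<le> L" "n \<le> 2 ^ L" "m * L \<le> n" "m \<le> L"
        and mL: "c0 / 8 * real n \<le> real (m * L)" "real (2 * L * m) \<le> c0 / 2 * real n"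
        and L2: "real (2 * L) \<le> real n powr (2 / 3) + 1" by blast
      let ?P = "samples \<tau> (H n)"
      let ?B2 = "poorly_linked \<tau> V2 (H n) L m" and ?B3 = "poorly_linked \<tau> V3 (H n) L m"
      have prob_B: "measure_pmf.prob ?P (poorly_linked \<tau> W (H n) L m) \<le> (1 / 2) ^ n"
        if "W = V2 \<or> W = V3" for W
      proof -
        have "8 * \<eta> * real (card (pverts (H n))) \<le> real (m * L)" using mL(1) by (simp add: H \<eta>_def)
        from prob_poorly_linked_le[OF H(1) k(2) k(1) L(1) _ _ _ L(4) _ this that, of \<tau>]
        show ?thesis using L elim(3) \<eta> small[of n] by (simp add: H)
      qed
      \<comment> \<open>The intersection with the support guarantees that samples are vertices of
        \<open>H n\<close>, from which \<open>M n \<omega>\<close> is a DAG; it does not change the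
        probability.\<close>
      have sub: "set_pmf ?P \<inter> - (?B2 \<union> ?B3) \<subseteq> good n"
      proof
        fix \<omega> assume \<omega>: "\<omega> \<in> set_pmf ?P \<inter> - (?B2 \<union> ?B3)"
        have "st_robust (card S) (n - card S) (M n \<omega>)"
          if S: "real (card S) \<le> c0 / 16 * real n / 2" for S :: "('a, 'b, 'c) mnode set"
          unfolding M_def
        proof (rule st_robust_M_graph[OF _ sc fg H(1) elim(2) _ _ _ L2 L(1)])
          show "dag (graph (M_graph \<tau> (H n) (SC1 n) (SC2 n) (f n) (g n) \<omega>))"
            using ioM[of \<omega> n] \<omega> by (simp add: io_dag_def M_def)
          show "\<omega> \<notin> ?B2" "\<omega> \<notin> ?B3" using \<omega> by auto
          have cn: "c0 * real n \<le> c * real n" "0 < c0 * real n"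
            using c0 elim(3) by (auto intro: mult_right_mono)
          have "real (card S + 2 * L * m) \<le> c0 * real n / 32 + c0 * real n / 2"
            using S mL(2) unfolding of_nat_add by linarith
          then show "real (card S + 2 * L * m) \<le> c * real n" using cn by linarith
          have "2 * real (card S) < real (m * L)" using S mL(1) cn(2) by linarith
          then have "real (2 * card S) < real (m * L)" by simp
          then show "2 * card S < m * L" by (simp only: of_nat_less_iff)
        qed
        then show "\<omega> \<in> good n" by (simp add: good_def)
      qed
      have "measure_pmf.prob ?P (?B2 \<union> ?B3) \<le> measure_pmf.prob ?P ?B2 + measure_pmf.prob ?P ?B3"
        by (rule measure_Un_le) auto
      also have "\<dots> \<le> 2 * (1 / 2) ^ n" using prob_B[of V2] prob_B[of V3] by simp
      finally have "1 - 2 * (1 / 2) ^ n \<le> 1 - measure_pmf.prob ?P (?B2 \<union> ?B3)" by simp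
      also have "\<dots> = measure_pmf.prob ?P (- (?B2 \<union> ?B3))"
        using measure_pmf.prob_compl[of "?B2 \<union> ?B3" ?P] by (simp add: Compl_eq_Diff_UNIV)
      also have "\<dots> = measure_pmf.prob ?P (set_pmf ?P \<inter> - (?B2 \<union> ?B3))"
        by (subst Int_commute) (simp only: measure_Int_set_pmf)
      also have "\<dots> \<le> measure_pmf.prob ?P (good n)"
        using sub by (intro measure_pmf.finite_measure_mono) auto
      finally show ?case .
    qed
    have lim: "(\<lambda>n. measure_pmf.prob (samples \<tau> (H n)) (good n)) \<longlonglongrightarrow> 1"
    proof (rule tendsto_sandwich[OF low])
      show "\<forall>\<^sub>F n in sequentially. measure_pmf.prob (samples \<tau> (H n)) (good n) \<le> 1" by simp
      show "(\<lambda>n. 1 - 2 * (1 / 2) ^ n :: real) \<longlonglongrightarrow> 1" by real_asymp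
    qed simp
    show "let M = (\<lambda>n. M_graph \<tau> (H n) (SC1 n) (SC2 n) (f n) (g n)) in
      (\<exists>c'>0.
        (\<lambda>n. measure_pmf.prob (samples \<tau> (H n))
           {\<omega>. \<forall>S \<subseteq> pverts (graph (M n \<omega>)). real (card S) \<le> c' * real n / 2 \<longrightarrow>
                 st_robust (card S) (n - card S) (M n \<omega>)}) \<longlonglongrightarrow> 1) \<and>
      (\<exists>k. \<forall>n. \<forall>\<omega> \<in> set_pmf (samples \<tau> (H n)).
         io_dag n (M n \<omega>) \<and> indegree_le k (graph (M n \<omega>)))"
      unfolding Let_def M_def[symmetric]
    proof (intro conjI)
      show "\<exists>c'>0. (\<lambda>n. measure_pmf.prob (samples \<tau> (H n))
           {\<omega>. \<forall>S \<subseteq> pverts (graph (M n \<omega>)). real (card S) \<le> c' * real n / 2 \<longrightarrow>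
                 st_robust (card S) (n - card S) (M n \<omega>)}) \<longlonglongrightarrow> 1"
        using lim c0(1) unfolding good_def by (intro exI[of _ "c0 / 16"]) simp
      show "\<exists>k. \<forall>n. \<forall>\<omega> \<in> set_pmf (samples \<tau> (H n)).
         io_dag n (M n \<omega>) \<and> indegree_le k (graph (M n \<omega>))"
        using ioM degM by blast
    qed
  qed
qed

end
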